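(* Let $\mathcal{F} = \{f_i\}_{i \in I}$ be a frame for $H$ with frame bounds $A$, $B$, and let $\mathcal{E} = \{e_j\}_{j \in G}$ be a frame for $H$ with frame bounds $E$, $F$. Let $a \colon I \to G$ be a map such that $D^+(I,a) < \infty$. If $(\mathcal{F}, a, \mathcal{E})$ has both $\ell^2$-column decay and $\ell^2$-row decay, then the following statements hold. (a) For each free ultrafilter $p$ on $\mathbf{N}$ and sequence of centers $c = (c_N)_{N \in \mathbf{N}}$ in $G$, we have $$\frac1{F}\, p\text{-}\lim_{N \in \mathbf{N}} \frac1{|S_N(c_N)|} \sum_{j \in S_N(c_N)} \|e_j\|^2 \le \frac{D(p,c)}{A}\, p\text{-}\lim_{N \in \mathbf{N}} \frac1{|I_N(c_N)|} \sum_{i \in I_N(c_N)} \|f_i\|^2,$$ $$\frac1{E}\, p\text{-}\lim_{N \in \mathbf{N}} \frac1{|S_N(c_N)|} \sum_{j \in S_N(c_N)} \|e_j\|^2 \ge \frac{D(p,c)}{B}\, p\text{-}\lim_{N \in \mathbf{N}} \frac1{|I_N(c_N)|} \sum_{i \in I_N(c_N)} \|f_i\|^2.$$ (b) We have $$\frac{A}{F} \, \frac{\liminf_{j} \|e_j\|^2}{\limsup_{i} \|f_i\|^2} \le D^-(I,a) \le D^+(I,a) \le \frac{B}{E} \, \frac{\limsup_{j} \|e_j\|^2}{\liminf_{i} \|f_i\|^2}.$$ (c) If $\mathcal{F}$ and $\mathcal{E}$ are both uniform norm frames, with $\|f_i\|^2 = \mathcal{N}_{\mathcal F}$ for all $i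 \in I$ and $\|e_j\|^2 = \mathcal{N}_{\mathcal E}$ for all $j \in G$, then $$\frac{A \, \mathcal{N}_{\mathcal E}}{F \, \mathcal{N}_{\mathcal F}} \le D^-(I,a) \le D^+(I,a) \le \frac{B \, \mathcal{N}_{\mathcal E}}{E \, \mathcal{N}_{\mathcal F}}.$$ Consequently, if $\mathcal{F}$ and $\mathcal{E}$ are both tight uniform norm frames (with $A=B$ and $E=F$), then $I$ has uniform density, with $D^-(I,a) = D^+(I,a) = (A \, \mathcal{N}_{\mathcal E})/(E \, \mathcal{N}_{\mathcal F})$.
   Context: $H$ is a separable Hilbert space and $I$ is a countable index set. $G = \prod_{i=1}^d a_i \mathbf{Z} \times \prod_{j=1}^e \mathbf{Z}_{n_j}$ (with $d \ge 1$, $a_i>0$, a countably infinite abelian group), equipped with $|g| = \sup\{|a_1 k_1|,\dots,|a_d k_d|,\delta(m_1),\dots,\delta(m_e)\}$ for $g=(a_1k_1,\dots,a_dk_d,m_1,\dots,m_e)$, where $\delta(0)=0$ and $\delta(m)=1$ for $m\neq 0$. For $N \in \mathbf{N}$ and $j\in G$ put $S_N(j) = \{k \in G : |k-j| \le N/2\}$ and $I_N(j) = a^{-1}(S_N(j))$. Densities: $D^-(I,a) = \liminf_{N\to\infty} \inf_{j\in G} |I_N(j)|/|S_N(j)|$, $D^+(I,a) = \limsup_{N\to\infty} \sup_{j\in G} |I_N(j)|/|S_N(j)|$, and $D(p,c) = p\text{-}\lim_{N} |I_N(c_N)|/|S_N(c_N)|$, where $p\text{-}\lim$ is the limit along the free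 ultrafilter $p$. $I$ has uniform density if $D^-(I,a)=D^+(I,a)$. Frame bounds $A,B>0$ of $\{f_i\}$ are constants with $A\|f\|^2 \le \sum_i |\langle f,f_i\rangle|^2 \le B\|f\|^2$ for all $f\in H$ (lower bound listed first); a tight frame is one for which one can take $A=B$. $(\mathcal{F},a,\mathcal{E})$ has $\ell^2$-column decay if for every $\varepsilon>0$ there is an integer $N_\varepsilon>0$ such that for all $j\in G$, $\sum_{i\in I\setminus I_{N_\varepsilon}(j)} |\langle f_i,e_j\rangle|^2<\varepsilon$. It has $\ell^2$-row decay if for every $\varepsilon>0$ there is an integer $N_\varepsilon>0$ such that for all $i\in I$, $\sum_{j\in G\setminus S_{N_\varepsilon}(a(i))} |\langle f_i,e_j\rangle|^2<\varepsilon$. Conventions: $\liminf$ and $\limsup$ over the index sets $I$, $G$ are taken along complements of finite sets, in $[0,\infty]$ (with $\inf\emptyset=\infty$, $\sup\emptyset=0$). An average over an empty set $I_N(c_N)$ is read as $0$. A quotient $x/0$ with $x>0$ is read as $\infty$ and $x/\infty$ with $x<\infty$ as $0$; the inequalities (and the final equality) involving a quotient are asserted only when the quotient is not of the form $0/0$. *)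

theory Defs
  imports
    "HOL-Analysis.Analysis"
    "HOL-Algebra.Elementary_Groups"
    "HOL-Algebra.Product_Groups"
begin

section \<open>Separable Hilbert spaces over the real or complex field\<close>

text \<open>
  The scalar field is left generic so that real and complex Hilbert spaces are treated at once:
  the real numbers (with trivial conjugation) and the complex numbers are instances, and by the
  Gelfand--Mazur theorem there are no others up to isomorphism.
\<close>

class hilbert_scalar = real_normed_field +
  fixes conjugation :: "'a \<Rightarrow> 'a"
  assumes conjugation_add: "conjugation (x + y) = conjugation x + conjugation y"
    and conjugation_mult: "conjugation (x * y) = conjugation x * conjugation y"
    and mult_conjugation_self: "x * conjugation x = (norm x)\<^sup>2 *\<^sub>R 1"

instantiation real :: hilbert_scalar
begin
definition "conjugation (x::real) = x"
instance by standard (simp_all add: conjugation_real_def power2_eq_square)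
end

instantiation complex :: hilbert_scalar
begin
definition "conjugation (z::complex) = cnj z"
instance
proof
  show "x * conjugation x = (norm x)\<^sup>2 *\<^sub>R 1" for x :: complex
    by (simp only: conjugation_complex_def complex_norm_square[symmetric] scaleR_conv_of_real mult_1_right)
qed (simp_all add: conjugation_complex_def)
end

locale separable_hilbert_space = vector_space scale
  for scale :: "'k::hilbert_scalar \<Rightarrow> 'h::banach \<Rightarrow> 'h" +
  fixes ip :: "'h \<Rightarrow> 'h \<Rightarrow> 'k"
  assumes scale_of_real: "scale (of_real r) x = r *\<^sub>R x"
    and ip_commute: "ip y x = conjugation (ip x y)"
    and ip_add_left: "ip (x + y) z = ip x z + ip y z"
    and ip_scale_left: "ip (scale c x) z = c * ip x z"
    and ip_self: "ip x x = of_real ((norm x)\<^sup>2)"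
    and separable: "separable_space (euclidean :: 'h topology)"

lemma separable_space_euclidean:
  "separable_space (euclidean :: 'a::{metric_space, second_countable_topology} topology)"
proof -
  obtain D :: "'a set" where "countable D" "D \<subseteq> UNIV" "UNIV \<subseteq> closure D"
    by (rule separable[of UNIV])
  then have "countable D \<and> D \<subseteq> topspace euclidean \<and> euclidean closure_of D = topspace euclidean"
    by (simp add: top.extremum_unique)
  then show ?thesis
    unfolding separable_space_def by (rule exI)
qed

lemma separable_hilbert_space_real_inner:
  "separable_hilbert_space (*\<^sub>R)
     (inner :: 'a::{real_inner, banach, second_countable_topology} \<Rightarrow> 'a \<Rightarrow> real)"
proof
  show "x \<bullet> x = of_real ((norm x)\<^sup>2)" for x :: 'a
    by (simp only: dot_square_norm of_real_eq_id id_apply)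
  show "y \<bullet> x = conjugation (x \<bullet> y)" for x y :: 'a
    by (simp only: conjugation_real_def) (rule inner_commute)
  show "separable_space (euclidean :: 'a topology)"
    by (rule separable_space_euclidean)
qed (simp_all only: scaleR_add_left scaleR_add_right scaleR_scaleR scaleR_one inner_add_left
    inner_scaleR_left of_real_eq_id id_apply)

lemma separable_hilbert_space_complex:
  "separable_hilbert_space (*) (\<lambda>x y. x * cnj y)"
proof
  show "x * cnj x = of_real ((norm x)\<^sup>2)" for x :: complex
    by (rule complex_norm_square[symmetric])
  show "separable_space (euclidean :: complex topology)"
    by (rule separable_space_euclidean)
  show "of_real r * x = r *\<^sub>R x" for r :: real and x :: complex
    by (rule scaleR_conv_of_real[symmetric])
  show "y * cnj x = conjugation (x * cnj y)" for x y :: complex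
    by (simp add: conjugation_complex_def)
qed (simp_all only: distrib_left distrib_right mult.assoc mult_1_left)


section \<open>Frames\<close>

definition is_frame ::
  "('h \<Rightarrow> 'h \<Rightarrow> 'k::real_normed_field) \<Rightarrow> ('i \<Rightarrow> 'h::real_normed_vector) \<Rightarrow> 'i set \<Rightarrow> real \<Rightarrow> real \<Rightarrow> bool"
  where "is_frame ip f I A B \<longleftrightarrow> A > 0 \<and> B > 0 \<and>
    (\<forall>h. ennreal (A * (norm h)\<^sup>2) \<le> (\<Sum>\<^sub>\<infinity>i\<in>I. ennreal ((norm (ip h (f i)))\<^sup>2)) \<and>
         (\<Sum>\<^sub>\<infinity>i\<in>I. ennreal ((norm (ip h (f i)))\<^sup>2)) \<le> ennreal (B * (norm h)\<^sup>2))"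


section \<open>The index group\<close>

text \<open>The subgroup \<open>\<alpha> \<int>\<close> of the additive group of the reals.\<close>

definition scaled_int_group :: "real \<Rightarrow> real monoid"
  where "scaled_int_group \<alpha> =
    \<lparr>carrier = range (\<lambda>k::int. \<alpha> * of_int k), monoid.mult = (+), one = 0\<rparr>"

text \<open>
  The lists \<open>\<alpha>s = [a_1, \<dots>, a_d]\<close> and \<open>ns = [n_1, \<dots>, n_e]\<close> carry the parameters of the group,
  including the numbers of factors \<open>d\<close> and \<open>e\<close>. Each entry of \<open>ns\<close> has to be positive, since
  \<open>integer_mod_group 0\<close> is infinite.
\<close>

definition index_group :: "real list \<Rightarrow> nat list \<Rightarrow> ((nat \<Rightarrow> real) \<times> (nat \<Rightarrow> int)) monoid"
  where "index_group \<alpha>s ns =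
    product_group {..<length \<alpha>s} (\<lambda>i. scaled_int_group (\<alpha>s ! i)) \<times>\<times>
    product_group {..<length ns} (\<lambda>j. integer_mod_group (ns ! j))"

definition group_size :: "real list \<Rightarrow> nat list \<Rightarrow> (nat \<Rightarrow> real) \<times> (nat \<Rightarrow> int) \<Rightarrow> real"
  where "group_size \<alpha>s ns g =
    Max ((\<lambda>i. \<bar>fst g i\<bar>) ` {..<length \<alpha>s} \<union>
         (\<lambda>j. if snd g j = 0 then 0 else 1) ` {..<length ns})"

lemma comm_group_scaled_int_group: "comm_group (scaled_int_group \<alpha>)"
proof (rule comm_groupI)
  fix x y assume "x \<in> carrier (scaled_int_group \<alpha>)" "y \<in> carrier (scaled_int_group \<alpha>)"
  then obtain k l :: int where "x = \<alpha> * of_int k" "y = \<alpha> * of_int l"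
    by (auto simp: scaled_int_group_def)
  then have "x + y \<in> range (\<lambda>k::int. \<alpha> * of_int k)"
    by (intro range_eqI[of _ _ "k + l"]) (simp add: distrib_left)
  then show "x \<otimes>\<^bsub>scaled_int_group \<alpha>\<^esub> y \<in> carrier (scaled_int_group \<alpha>)"
    by (simp add: scaled_int_group_def)
next
  have "0 \<in> range (\<lambda>k::int. \<alpha> * of_int k)"
    by (rule range_eqI[of _ _ 0]) simp
  then show "\<one>\<^bsub>scaled_int_group \<alpha>\<^esub> \<in> carrier (scaled_int_group \<alpha>)"
    by (simp add: scaled_int_group_def)
next
  fix x assume "x \<in> carrier (scaled_int_group \<alpha>)"
  then obtain k :: int where "x = \<alpha> * of_int k"
    by (auto simp: scaled_int_group_def)
  then have "- x \<in> range (\<lambda>k::int. \<alpha> * of_int k)"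
    by (intro range_eqI[of _ _ "- k"]) simp
  then have "- x \<in> carrier (scaled_int_group \<alpha>)"
    by (simp add: scaled_int_group_def)
  then show "\<exists>y\<in>carrier (scaled_int_group \<alpha>). y \<otimes>\<^bsub>scaled_int_group \<alpha>\<^esub> x = \<one>\<^bsub>scaled_int_group \<alpha>\<^esub>"
    by (rule rev_bexI) (simp add: scaled_int_group_def)
qed (simp_all add: scaled_int_group_def)

lemma comm_group_index_group: "comm_group (index_group \<alpha>s ns)"
proof (rule group.group_comm_groupI)
  show "group (index_group \<alpha>s ns)"
    unfolding index_group_def
    by (intro DirProd_group product_group comm_group.axioms(2)[OF comm_group_scaled_int_group]
        group_integer_mod_group)
  have "u \<otimes>\<^bsub>scaled_int_group \<alpha>\<^esub> v = v \<otimes>\<^bsub>scaled_int_group \<alpha>\<^esub> u" for \<alpha> u v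
    by (simp add: scaled_int_group_def)
  moreover have "u \<otimes>\<^bsub>integer_mod_group n\<^esub> v = v \<otimes>\<^bsub>integer_mod_group n\<^esub> u" for n u v
    by (simp add: integer_mod_group_def integer_group_def add.commute)
  ultimately show "x \<otimes>\<^bsub>index_group \<alpha>s ns\<^esub> y = y \<otimes>\<^bsub>index_group \<alpha>s ns\<^esub> x" for x y
    by (cases x, cases y) (auto simp only: index_group_def product_group_def mult_DirProd
        monoid.select_convs intro!: restrict_ext)
qed


section \<open>Boxes and densities\<close>

definition box_at ::
  "real list \<Rightarrow> nat list \<Rightarrow> nat \<Rightarrow> (nat \<Rightarrow> real) \<times> (nat \<Rightarrow> int) \<Rightarrow> ((nat \<Rightarrow> real) \<times> (nat \<Rightarrow> int)) set"
  where "box_at \<alpha>s ns N j =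
    {k \<in> carrier (index_group \<alpha>s ns).
       group_size \<alpha>s ns (k \<otimes>\<^bsub>index_group \<alpha>s ns\<^esub> inv\<^bsub>index_group \<alpha>s ns\<^esub> j) \<le> real N / 2}"

definition pre_box ::
  "real list \<Rightarrow> nat list \<Rightarrow> 'i set \<Rightarrow> ('i \<Rightarrow> (nat \<Rightarrow> real) \<times> (nat \<Rightarrow> int)) \<Rightarrow>
    nat \<Rightarrow> (nat \<Rightarrow> real) \<times> (nat \<Rightarrow> int) \<Rightarrow> 'i set"
  where "pre_box \<alpha>s ns I a N j = {i \<in> I. a i \<in> box_at \<alpha>s ns N j}"

text \<open>
  Cardinalities are taken in \<open>[0, \<infinity>]\<close>, because the sets \<open>pre_box \<alpha>s ns I a N j\<close> may be infinite
  when the upper density is infinite.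
\<close>

definition box_ratio ::
  "real list \<Rightarrow> nat list \<Rightarrow> 'i set \<Rightarrow> ('i \<Rightarrow> (nat \<Rightarrow> real) \<times> (nat \<Rightarrow> int)) \<Rightarrow>
    nat \<Rightarrow> (nat \<Rightarrow> real) \<times> (nat \<Rightarrow> int) \<Rightarrow> ennreal"
  where "box_ratio \<alpha>s ns I a N j =
    emeasure (count_space UNIV) (pre_box \<alpha>s ns I a N j) /
    emeasure (count_space UNIV) (box_at \<alpha>s ns N j)"

definition lower_density ::
  "real list \<Rightarrow> nat list \<Rightarrow> 'i set \<Rightarrow> ('i \<Rightarrow> (nat \<Rightarrow> real) \<times> (nat \<Rightarrow> int)) \<Rightarrow> ennreal"
  where "lower_density \<alpha>s ns I a =
    liminf (\<lambda>N. INF j\<in>carrier (index_group \<alpha>s ns). box_ratio \<alpha>s ns I a N j)"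

definition upper_density ::
  "real list \<Rightarrow> nat list \<Rightarrow> 'i set \<Rightarrow> ('i \<Rightarrow> (nat \<Rightarrow> real) \<times> (nat \<Rightarrow> int)) \<Rightarrow> ennreal"
  where "upper_density \<alpha>s ns I a =
    limsup (\<lambda>N. SUP j\<in>carrier (index_group \<alpha>s ns). box_ratio \<alpha>s ns I a N j)"

definition uniform_density ::
  "real list \<Rightarrow> nat list \<Rightarrow> 'i set \<Rightarrow> ('i \<Rightarrow> (nat \<Rightarrow> real) \<times> (nat \<Rightarrow> int)) \<Rightarrow> bool"
  where "uniform_density \<alpha>s ns I a \<longleftrightarrow> lower_density \<alpha>s ns I a = upper_density \<alpha>s ns I a"

definition free_ultrafilter :: "nat filter \<Rightarrow> bool"
  where "free_ultrafilter p \<longleftrightarrow> p \<noteq> bot \<and>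
    (\<forall>P. eventually P p \<or> eventually (\<lambda>N. \<not> P N) p) \<and>
    (\<forall>P. eventually P p \<longrightarrow> infinite {N. P N})"

text \<open>
  All limits along ultrafilters are taken in the compact space \<open>[0, \<infinity>]\<close>, where they always exist,
  so that \<open>Lim\<close> is never applied to a divergent family.
\<close>

definition density_along ::
  "real list \<Rightarrow> nat list \<Rightarrow> 'i set \<Rightarrow> ('i \<Rightarrow> (nat \<Rightarrow> real) \<times> (nat \<Rightarrow> int)) \<Rightarrow>
    nat filter \<Rightarrow> (nat \<Rightarrow> (nat \<Rightarrow> real) \<times> (nat \<Rightarrow> int)) \<Rightarrow> ennreal"
  where "density_along \<alpha>s ns I a p c = Lim p (\<lambda>N. box_ratio \<alpha>s ns I a N (c N))"

text \<open>
  The average over the empty set is \<open>0\<close>. The average is only meaningful on finite sets, and it is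
  only used for these: the boxes are finite, and their preimages are finite if the upper density is.
\<close>

definition average_on :: "'s set \<Rightarrow> ('s \<Rightarrow> real) \<Rightarrow> ennreal"
  where "average_on S x = ennreal ((\<Sum>s\<in>S. x s) / real (card S))"

text \<open>Lower and upper limits over an index set, along the complements of its finite subsets.\<close>

definition liminf_on :: "'s set \<Rightarrow> ('s \<Rightarrow> real) \<Rightarrow> ennreal"
  where "liminf_on S x = Liminf (inf cofinite (principal S)) (\<lambda>s. ennreal (x s))"

definition limsup_on :: "'s set \<Rightarrow> ('s \<Rightarrow> real) \<Rightarrow> ennreal"
  where "limsup_on S x = Limsup (inf cofinite (principal S)) (\<lambda>s. ennreal (x s))"


section \<open>Decay of the cross-Gram matrix\<close>

definition l2_column_decay ::
  "real list \<Rightarrow> nat list \<Rightarrow> ('h \<Rightarrow> 'h \<Rightarrow> 'k::real_normed_field) \<Rightarrow> ('i \<Rightarrow> 'h) \<Rightarrow> 'i set \<Rightarrow>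
    ('i \<Rightarrow> (nat \<Rightarrow> real) \<times> (nat \<Rightarrow> int)) \<Rightarrow> ((nat \<Rightarrow> real) \<times> (nat \<Rightarrow> int) \<Rightarrow> 'h) \<Rightarrow> bool"
  where "l2_column_decay \<alpha>s ns ip f I a e \<longleftrightarrow>
    (\<forall>\<epsilon>>0. \<exists>N>0. \<forall>j\<in>carrier (index_group \<alpha>s ns).
      (\<Sum>\<^sub>\<infinity>i\<in>I - pre_box \<alpha>s ns I a N j. ennreal ((norm (ip (f i) (e j)))\<^sup>2)) < ennreal \<epsilon>)"

definition l2_row_decay ::
  "real list \<Rightarrow> nat list \<Rightarrow> ('h \<Rightarrow> 'h \<Rightarrow> 'k::real_normed_field) \<Rightarrow> ('i \<Rightarrow> 'h) \<Rightarrow> 'i set \<Rightarrow>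
    ('i \<Rightarrow> (nat \<Rightarrow> real) \<times> (nat \<Rightarrow> int)) \<Rightarrow> ((nat \<Rightarrow> real) \<times> (nat \<Rightarrow> int) \<Rightarrow> 'h) \<Rightarrow> bool"
  where "l2_row_decay \<alpha>s ns ip f I a e \<longleftrightarrow>
    (\<forall>\<epsilon>>0. \<exists>N>0. \<forall>i\<in>I.
      (\<Sum>\<^sub>\<infinity>j\<in>carrier (index_group \<alpha>s ns) - box_at \<alpha>s ns N (a i).
         ennreal ((norm (ip (f i) (e j)))\<^sup>2)) < ennreal \<epsilon>)"

end

theory Submission
  imports Defs
begin

text \<open>
  Write \<open>s_N\<close> for the common number of points of the boxes \<open>S_N(c)\<close>. All three parts come from two
  inequalities between sums over the same box: for every \<open>\<epsilon> > 0\<close> and all large \<open>N\<close>,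
  uniformly in the centre \<open>c\<close>,
    \<open>A \<Sum>_{j \<in> S_N(c)} \<parallel>e_j\<parallel>\<^sup>2 \<le> F \<Sum>_{i \<in> I_N(c)} \<parallel>f_i\<parallel>\<^sup>2 + \<epsilon> s_N\<close> and
    \<open>E \<Sum>_{i \<in> I_N(c)} \<parallel>f_i\<parallel>\<^sup>2 \<le> B \<Sum>_{j \<in> S_N(c)} \<parallel>e_j\<parallel>\<^sup>2 + \<epsilon> s_N\<close>.

  The first one (\<open>e_sum_le_f_sum\<close>) counts the matrix \<open>|\<langle>f_i, e_j\<rangle>|\<^sup>2\<close> in two ways. By the lower frame
  inequality at \<open>e_j\<close>, the column of \<open>j\<close> has sum at least \<open>A \<parallel>e_j\<parallel>\<^sup>2\<close>; for \<open>j \<in> S_N(c)\<close>, column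
  decay puts all but \<open>\<epsilon>\<close> of it on the rows in \<open>I_{N+M}(c)\<close>, with \<open>M\<close> depending on \<open>\<epsilon>\<close> alone. By the
  upper frame inequality at \<open>f_i\<close>, each of these rows has sum at most \<open>F \<parallel>f_i\<parallel>\<^sup>2\<close>. The second one
  (\<open>f_sum_le_e_sum\<close>) is the same count with the roles exchanged, using row decay, and both are
  instances of \<open>frame_double_counting\<close>.

  The enlargement from \<open>N\<close> to \<open>N + M\<close> costs little: frame vectors are bounded, boxes satisfy
  \<open>s_{N+M} / s_N \<rightarrow> 1\<close> (\<open>box_shell_small\<close>), and finiteness of the upper density bounds the fibres of
  \<open>a\<close>, so that \<open>I_{N+M}(c)\<close> exceeds \<open>I_N(c)\<close> by \<open>o(s_N)\<close> points as well (\<open>ipre_shell_small\<close>).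

  Dividing by \<open>s_N\<close> gives everything else. The average of \<open>\<parallel>f_i\<parallel>\<^sup>2\<close> over \<open>I_N(c)\<close> times
  \<open>|I_N(c)| / s_N\<close> is the \<open>f\<close>-sum divided by \<open>s_N\<close>, so a limit along the ultrafilter yields (a).
  For (b) and (c), bounds on \<open>\<parallel>e_j\<parallel>\<^sup>2\<close> and \<open>\<parallel>f_i\<parallel>\<^sup>2\<close> outside finite sets turn the two inequalities
  into bounds on \<open>|I_N(c)| / s_N\<close>, uniform in \<open>c\<close>, because finitely many exceptional vectors are
  negligible against \<open>s_N \<rightarrow> \<infinity>\<close> (\<open>lower_density_bound\<close>, \<open>upper_density_bound\<close>).
\<close>


section \<open>Double counting with two frames\<close>

lemma norm_conjugation: "norm (conjugation x) = norm (x :: 'k::hilbert_scalar)"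
proof (cases "x = 0")
  case True
  have "conjugation (0::'k) = 0"
    using conjugation_add[of "0::'k" 0] by simp
  with True show ?thesis by simp
next
  case False
  have "norm x * norm (conjugation x) = norm x * norm x"
    using arg_cong[OF mult_conjugation_self[of x], of norm]
    by (simp add: norm_mult power2_eq_square)
  with False show ?thesis by simp
qed

lemma sum_le_infsum_ennreal:
  fixes g :: "'s \<Rightarrow> ennreal"
  assumes "finite P" "P \<subseteq> S"
  shows "sum g P \<le> infsum g S"
  using infsum_mono_neutral[of g P g S] assms by (auto simp: nonneg_summable_on_complete)

lemma infsum_ennreal_mono_set:
  fixes g :: "'s \<Rightarrow> ennreal"
  assumes "S \<subseteq> T"
  shows "infsum g S \<le> infsum g T"
  using infsum_mono_neutral[of g S g T] assms by (auto simp: nonneg_summable_on_complete)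

context separable_hilbert_space
begin

lemma norm_ip_commute: "norm (ip x y) = norm (ip y x)"
  by (subst ip_commute) (rule norm_conjugation)

lemma norm_ip_self: "norm (ip x x) = (norm x)\<^sup>2"
  unfolding ip_self norm_of_real by simp

text \<open>
  The upper frame inequality at \<open>h = u s\<close> has the term \<open>\<parallel>u s\<parallel>\<^sup>4\<close> on its left, and one factor
  \<open>\<parallel>u s\<parallel>\<^sup>2\<close> cancels.
\<close>

lemma frame_norm_bound:
  assumes "is_frame ip u S A B" and "s \<in> S"
  shows "(norm (u s))\<^sup>2 \<le> B"
proof -
  have "ennreal ((norm (ip (u s) (u s)))\<^sup>2) \<le> (\<Sum>\<^sub>\<infinity>t\<in>S. ennreal ((norm (ip (u s) (u t)))\<^sup>2))"
    using sum_le_infsum_ennreal[of "{s}" S "\<lambda>t. ennreal ((norm (ip (u s) (u t)))\<^sup>2)"] assms(2)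
    by simp
  also have "\<dots> \<le> ennreal (B * (norm (u s))\<^sup>2)"
    using assms(1) by (simp add: is_frame_def)
  finally have le: "(norm (u s))\<^sup>2 * (norm (u s))\<^sup>2 \<le> B * (norm (u s))\<^sup>2"
    unfolding norm_ip_self power2_eq_square[of "(norm (u s))\<^sup>2"]
    using assms(1) by (subst (asm) ennreal_le_iff) (auto simp: is_frame_def)
  show ?thesis
  proof (cases "u s = 0")
    case False
    then show ?thesis using le by (intro mult_right_le_imp_le[OF le]) simp
  qed (use assms(1) in \<open>auto simp: is_frame_def\<close>)
qed

text \<open>
  Sum \<open>|\<langle>u_s, v_t\<rangle>|\<^sup>2\<close> over \<open>P \<times> Q\<close> in both orders: the lower inequality for \<open>v\<close>, less the tail outside
  \<open>Q\<close>, bounds the sum over \<open>t\<close> from below, and the upper inequality for \<open>u\<close> bounds the sum over \<open>s\<close>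
  from above.
\<close>

lemma frame_double_counting:
  assumes v: "is_frame ip v T A B" and u: "is_frame ip u S E F"
    and P: "finite P" "P \<subseteq> S" and Q: "finite Q" "Q \<subseteq> T" and \<epsilon>: "\<epsilon> \<ge> 0"
    and tail: "\<And>s. s \<in> P \<Longrightarrow> (\<Sum>\<^sub>\<infinity>t\<in>T - Q. ennreal ((norm (ip (u s) (v t)))\<^sup>2)) \<le> ennreal \<epsilon>"
  shows "A * (\<Sum>s\<in>P. (norm (u s))\<^sup>2) \<le> F * (\<Sum>t\<in>Q. (norm (v t))\<^sup>2) + \<epsilon> * card P"
proof -
  let ?w = "\<lambda>s t. (norm (ip (u s) (v t)))\<^sup>2"
  have row: "A * (norm (u s))\<^sup>2 \<le> (\<Sum>t\<in>Q. ?w s t) + \<epsilon>" if "s \<in> P" for s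
  proof -
    have "ennreal (A * (norm (u s))\<^sup>2) \<le> (\<Sum>\<^sub>\<infinity>t\<in>T. ennreal (?w s t))"
      using v by (simp add: is_frame_def)
    also have "\<dots> = (\<Sum>\<^sub>\<infinity>t\<in>Q \<union> (T - Q). ennreal (?w s t))"
      using Q(2) by (simp add: Un_absorb1)
    also have "\<dots> = (\<Sum>\<^sub>\<infinity>t\<in>Q. ennreal (?w s t)) + (\<Sum>\<^sub>\<infinity>t\<in>T - Q. ennreal (?w s t))"
      by (intro infsum_Un_disjoint nonneg_summable_on_complete) auto
    also have "\<dots> \<le> ennreal (\<Sum>t\<in>Q. ?w s t) + ennreal \<epsilon>"
      using Q(1) tail[OF that] by (intro add_mono) (simp_all add: sum_ennreal)
    also have "\<dots> = ennreal ((\<Sum>t\<in>Q. ?w s t) + \<epsilon>)"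
      using \<epsilon> by (simp add: sum_nonneg)
    finally show ?thesis
      using \<epsilon> by (subst (asm) ennreal_le_iff) (auto intro!: add_nonneg_nonneg sum_nonneg)
  qed
  have column: "(\<Sum>s\<in>P. ?w s t) \<le> F * (norm (v t))\<^sup>2" for t
  proof -
    have "ennreal (\<Sum>s\<in>P. ?w s t) = (\<Sum>s\<in>P. ennreal ((norm (ip (v t) (u s)))\<^sup>2))"
      by (simp add: norm_ip_commute[of "v t"] sum_ennreal)
    also have "\<dots> \<le> (\<Sum>\<^sub>\<infinity>s\<in>S. ennreal ((norm (ip (v t) (u s)))\<^sup>2))"
      by (rule sum_le_infsum_ennreal) (use P in auto)
    also have "\<dots> \<le> ennreal (F * (norm (v t))\<^sup>2)"
      using u by (simp add: is_frame_def)
    finally show ?thesis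
      using u by (subst (asm) ennreal_le_iff) (auto simp: is_frame_def)
  qed
  have "A * (\<Sum>s\<in>P. (norm (u s))\<^sup>2) \<le> (\<Sum>s\<in>P. (\<Sum>t\<in>Q. ?w s t) + \<epsilon>)"
    unfolding sum_distrib_left by (rule sum_mono) (rule row)
  also have "\<dots> = (\<Sum>t\<in>Q. \<Sum>s\<in>P. ?w s t) + \<epsilon> * card P"
    by (simp add: sum.distrib sum.swap[of _ Q])
  also have "\<dots> \<le> F * (\<Sum>t\<in>Q. (norm (v t))\<^sup>2) + \<epsilon> * card P"
    unfolding sum_distrib_left by (intro add_right_mono sum_mono column)
  finally show ?thesis .
qed

end


section \<open>Size of the boxes\<close>

locale index_lattice =
  fixes \<alpha>s :: "real list" and ns :: "nat list"
  assumes length_pos: "length \<alpha>s \<ge> 1"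
    and steps_pos: "\<forall>\<alpha>\<in>set \<alpha>s. \<alpha> > 0"
    and orders_pos: "\<forall>n\<in>set ns. n > 0"
begin

abbreviation "G \<equiv> carrier (index_group \<alpha>s ns)"
abbreviation "ibox \<equiv> box_at \<alpha>s ns"

lemma carrier_index_group:
  "G = (\<Pi>\<^sub>E i\<in>{..<length \<alpha>s}. range (\<lambda>k::int. \<alpha>s ! i * of_int k)) \<times>
       (\<Pi>\<^sub>E l\<in>{..<length ns}. {0..<int (ns ! l)})"
proof -
  have "carrier (integer_mod_group (ns ! l)) = {0..<int (ns ! l)}" if "l < length ns" for l
    using orders_pos that by (fastforce simp: carrier_integer_mod_group in_set_conv_nth)
  then have *: "(\<Pi>\<^sub>E l\<in>{..<length ns}. carrier (integer_mod_group (ns ! l))) =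
      (\<Pi>\<^sub>E l\<in>{..<length ns}. {0..<int (ns ! l)})"
    by (intro PiE_cong) simp
  show ?thesis
    by (simp add: index_group_def * scaled_int_group_def)
qed

lemma inv_scaled_int_group:
  assumes "x \<in> carrier (scaled_int_group \<alpha>)"
  shows "inv\<^bsub>scaled_int_group \<alpha>\<^esub> x = - x"
proof (rule group.inv_equality)
  show "group (scaled_int_group \<alpha>)"
    by (rule comm_group.axioms(2)[OF comm_group_scaled_int_group])
  show "- x \<in> carrier (scaled_int_group \<alpha>)"
    using assms by (auto simp: scaled_int_group_def) (metis mult_minus_right of_int_minus rangeI)
qed (use assms in \<open>auto simp: scaled_int_group_def\<close>)

lemma fst_difference:
  assumes "k \<in> G" "j \<in> G" "i < length \<alpha>s"
  shows "fst (k \<otimes>\<^bsub>index_group \<alpha>s ns\<^esub> inv\<^bsub>index_group \<alpha>s ns\<^esub> j) i = fst k i - fst j i"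
proof -
  obtain k1 k2 j1 j2 where kj: "k = (k1, k2)" "j = (j1, j2)" by (cases k, cases j)
  let ?P = "product_group {..<length \<alpha>s} (\<lambda>i. scaled_int_group (\<alpha>s ! i))"
  let ?Q = "product_group {..<length ns} (\<lambda>j. integer_mod_group (ns ! j))"
  have P: "group ?P"
    by (intro product_group comm_group.axioms(2)[OF comm_group_scaled_int_group])
  have Q: "group ?Q"
    by (intro product_group group_integer_mod_group)
  have j: "j1 \<in> carrier ?P" "j2 \<in> carrier ?Q"
    using assms(2) kj by (auto simp: index_group_def)
  have "inv\<^bsub>?P\<^esub> j1 = (\<lambda>i\<in>{..<length \<alpha>s}. inv\<^bsub>scaled_int_group (\<alpha>s ! i)\<^esub> j1 i)"
    using j(1) by (subst inv_product_group)
      (auto intro: comm_group.axioms(2)[OF comm_group_scaled_int_group])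
  moreover have "j1 i \<in> carrier (scaled_int_group (\<alpha>s ! i))"
    using j(1) assms(3) by (auto simp: PiE_iff)
  ultimately have "(inv\<^bsub>?P\<^esub> j1) i = - j1 i"
    using assms(3) by (simp add: inv_scaled_int_group)
  then have "(k1 \<otimes>\<^bsub>?P\<^esub> inv\<^bsub>?P\<^esub> j1) i = k1 i - j1 i"
    using assms(3) by (simp add: product_group_def scaled_int_group_def)
  then show ?thesis
    using j kj by (simp add: index_group_def inv_DirProd[OF P Q])
qed

text \<open>
  For \<open>N \<ge> 2\<close> the cyclic coordinates impose no condition, since each contributes at most \<open>1 \<le> N / 2\<close>
  to the size of an element.
\<close>

lemma box_eq:
  assumes "N \<ge> 2" "j \<in> G"
  shows "ibox N j = {k \<in> G. \<forall>i<length \<alpha>s. \<bar>fst k i - fst j i\<bar> \<le> real N / 2}"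
proof -
  have "0 \<in> {..<length \<alpha>s}" using length_pos by force
  then have "group_size \<alpha>s ns (k \<otimes>\<^bsub>index_group \<alpha>s ns\<^esub> inv\<^bsub>index_group \<alpha>s ns\<^esub> j) \<le> real N / 2 \<longleftrightarrow>
      (\<forall>i<length \<alpha>s. \<bar>fst k i - fst j i\<bar> \<le> real N / 2)" if "k \<in> G" for k
    using assms(1) fst_difference[OF that assms(2)]
    unfolding group_size_def by (subst Max_le_iff) auto
  then show ?thesis
    unfolding box_at_def by blast
qed

lemma box_mono: "M \<le> N \<Longrightarrow> ibox M j \<subseteq> ibox N j"
  by (auto simp: box_at_def)

lemma box_subset_G: "ibox N j \<subseteq> G"
  by (auto simp: box_at_def)

lemma box_triangle:
  assumes "M \<ge> 2" "N \<ge> 2" "c \<in> G" "j \<in> ibox N c"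
  shows "ibox M j \<subseteq> ibox (N + M) c"
proof
  have j: "j \<in> G" using assms(4) box_subset_G by blast
  fix k assume k: "k \<in> ibox M j"
  have "\<bar>fst k i - fst c i\<bar> \<le> real (N + M) / 2" if "i < length \<alpha>s" for i
  proof -
    have "\<bar>fst k i - fst j i\<bar> \<le> real M / 2" "\<bar>fst j i - fst c i\<bar> \<le> real N / 2"
      using k assms j that by (auto simp: box_eq)
    moreover have "\<bar>fst k i - fst c i\<bar> \<le> \<bar>fst k i - fst j i\<bar> + \<bar>fst j i - fst c i\<bar>"
      by linarith
    moreover have "real (N + M) / 2 = real M / 2 + real N / 2"
      by simp
    ultimately show ?thesis by linarith
  qed
  with k assms j show "k \<in> ibox (N + M) c"
    by (simp add: box_eq)
qed

definition side_count :: "nat \<Rightarrow> nat \<Rightarrow> nat"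
  where "side_count i N = 2 * nat \<lfloor>real N / (2 * \<alpha>s ! i)\<rfloor> + 1"

definition box_card :: "nat \<Rightarrow> nat"
  where "box_card N = (\<Prod>i<length \<alpha>s. side_count i N) * (\<Prod>l<length ns. ns ! l)"

lemma card_side:
  assumes "\<alpha> > 0" "x \<in> range (\<lambda>k::int. \<alpha> * of_int k)"
  shows "finite {y \<in> range (\<lambda>k::int. \<alpha> * of_int k). \<bar>y - x\<bar> \<le> real N / 2}"
    and "card {y \<in> range (\<lambda>k::int. \<alpha> * of_int k). \<bar>y - x\<bar> \<le> real N / 2} =
           2 * nat \<lfloor>real N / (2 * \<alpha>)\<rfloor> + 1"
proof -
  obtain m :: int where m: "x = \<alpha> * of_int m" using assms(2) by auto
  let ?r = "\<lfloor>real N / (2 * \<alpha>)\<rfloor>"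
  have r: "?r \<ge> 0" using assms(1) by simp
  have "\<bar>\<alpha> * of_int k - x\<bar> \<le> real N / 2 \<longleftrightarrow> k \<in> {m - ?r..m + ?r}" for k :: int
  proof -
    have "\<bar>\<alpha> * of_int k - x\<bar> = \<alpha> * of_int \<bar>k - m\<bar>"
      using assms(1) m by (simp add: abs_mult flip: right_diff_distrib)
    then have "\<bar>\<alpha> * of_int k - x\<bar> \<le> real N / 2 \<longleftrightarrow> of_int \<bar>k - m\<bar> \<le> real N / (2 * \<alpha>)"
      using assms(1) by (simp add: field_simps)
    also have "\<dots> \<longleftrightarrow> \<bar>k - m\<bar> \<le> ?r" by (simp add: le_floor_iff)
    finally show ?thesis by auto
  qed
  then have eq: "{y \<in> range (\<lambda>k::int. \<alpha> * of_int k). \<bar>y - x\<bar> \<le> real N / 2} =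
      (\<lambda>k::int. \<alpha> * of_int k) ` {m - ?r..m + ?r}"
    by blast
  show "finite {y \<in> range (\<lambda>k::int. \<alpha> * of_int k). \<bar>y - x\<bar> \<le> real N / 2}"
    unfolding eq by simp
  have "inj_on (\<lambda>k::int. \<alpha> * of_int k) {m - ?r..m + ?r}"
    using assms(1) by (auto simp: inj_on_def)
  then show "card {y \<in> range (\<lambda>k::int. \<alpha> * of_int k). \<bar>y - x\<bar> \<le> real N / 2} =
           2 * nat \<lfloor>real N / (2 * \<alpha>)\<rfloor> + 1"
    unfolding eq using r by (subst card_image) (auto simp: nat_add_distrib nat_mult_distrib)
qed

text \<open>
  A box is a product of symmetric intervals in the lattice directions with the full cyclic factors,
  so its cardinality does not depend on its centre.
\<close>

lemma box_finite_card:
  assumes "N \<ge> 2" "c \<in> G"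
  shows "finite (ibox N c)" and "card (ibox N c) = box_card N"
proof -
  let ?side = "\<lambda>i. {y \<in> range (\<lambda>k::int. \<alpha>s ! i * of_int k). \<bar>y - fst c i\<bar> \<le> real N / 2}"
  have eq: "ibox N c = (\<Pi>\<^sub>E i\<in>{..<length \<alpha>s}. ?side i) \<times> (\<Pi>\<^sub>E l\<in>{..<length ns}. {0..<int (ns ! l)})"
    unfolding box_eq[OF assms] carrier_index_group by (auto simp: PiE_iff)
  have side: "finite (?side i)" "card (?side i) = side_count i N" if "i < length \<alpha>s" for i
    using card_side[of "\<alpha>s ! i" "fst c i" N] steps_pos assms(2) that
    by (auto simp: carrier_index_group PiE_iff side_count_def)
  show "finite (ibox N c)"
    unfolding eq using side by (intro finite_cartesian_product finite_PiE) auto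
  show "card (ibox N c) = box_card N"
    unfolding eq card_cartesian_product using side by (simp add: card_PiE box_card_def)
qed

lemma side_count_at_top:
  assumes "i < length \<alpha>s"
  shows "filterlim (\<lambda>N. real (side_count i N)) at_top sequentially"
proof (rule filterlim_at_top_mono)
  have pos: "\<alpha>s ! i > 0" using steps_pos assms by simp
  show "\<forall>\<^sub>F N in sequentially. - 1 + 1 / \<alpha>s ! i * real N \<le> real (side_count i N)"
  proof (rule always_eventually, rule allI)
    fix N
    have "real N / (2 * \<alpha>s ! i) - 1 \<le> real_of_int \<lfloor>real N / (2 * \<alpha>s ! i)\<rfloor>" by linarith
    then show "- 1 + 1 / \<alpha>s ! i * real N \<le> real (side_count i N)"
      using pos by (simp add: side_count_def field_simps)
  qed
  show "filterlim (\<lambda>N. - 1 + 1 / \<alpha>s ! i * real N) at_top sequentially"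
    using pos by (intro filterlim_tendsto_add_at_top[OF tendsto_const]
        filterlim_tendsto_pos_mult_at_top[OF tendsto_const] filterlim_real_sequentially) simp
qed

text \<open>
  The side grows by at most a constant when \<open>N\<close> becomes \<open>N + M\<close>, while it tends to infinity.
\<close>

lemma side_count_ratio:
  assumes "i < length \<alpha>s"
  shows "(\<lambda>N. real (side_count i (N + M)) / real (side_count i N)) \<longlonglongrightarrow> 1"
proof (rule tendsto_sandwich)
  have pos: "\<alpha>s ! i > 0" using steps_pos assms by simp
  let ?b = "real M / \<alpha>s ! i + 2"
  have "side_count i N \<le> side_count i (N + M)" for N
    unfolding side_count_def using pos by (auto intro!: nat_mono floor_mono divide_right_mono)
  then show "\<forall>\<^sub>F N in sequentially. 1 \<le> real (side_count i (N + M)) / real (side_count i N)"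
    by (intro always_eventually allI) (simp add: side_count_def)
  have "real (side_count i (N + M)) \<le> real (side_count i N) + ?b" for N
  proof -
    have "real (N + M) / (2 * \<alpha>s ! i) = real N / (2 * \<alpha>s ! i) + real M / (2 * \<alpha>s ! i)"
      by (simp add: add_divide_distrib)
    then have "real_of_int \<lfloor>real (N + M) / (2 * \<alpha>s ! i)\<rfloor> \<le>
        real_of_int \<lfloor>real N / (2 * \<alpha>s ! i)\<rfloor> + 1 + real M / (2 * \<alpha>s ! i)"
      by linarith
    then show ?thesis using pos by (simp add: side_count_def field_simps)
  qed
  moreover have "real (side_count i N) > 0" for N
    by (simp add: side_count_def)
  ultimately have "real (side_count i (N + M)) / real (side_count i N) \<le>
      1 + ?b / real (side_count i N)" for N
    by (metis add_divide_distrib divide_right_mono less_eq_real_def divide_self less_irrefl)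
  then show "\<forall>\<^sub>F N in sequentially. real (side_count i (N + M)) / real (side_count i N) \<le>
      1 + ?b / real (side_count i N)"
    by simp
  have "(\<lambda>N. ?b / real (side_count i N)) \<longlonglongrightarrow> 0"
    by (rule tendsto_divide_0[OF tendsto_const
        filterlim_at_top_imp_at_infinity[OF side_count_at_top[OF assms]]])
  then show "(\<lambda>N. 1 + ?b / real (side_count i N)) \<longlonglongrightarrow> 1"
    using tendsto_add[OF tendsto_const, of _ 0 sequentially "1::real"] by simp
qed simp

lemma box_card_pos: "box_card N > 0"
  using orders_pos by (auto simp: box_card_def side_count_def intro!: prod_pos)

lemma box_card_at_top: "filterlim (\<lambda>N. real (box_card N)) at_top sequentially"
proof (rule filterlim_at_top_mono[OF side_count_at_top])
  show "0 < length \<alpha>s" using length_pos by force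
  have "side_count 0 N \<le> box_card N" for N
  proof (rule dvd_imp_le)
    have "side_count 0 N dvd (\<Prod>i<length \<alpha>s. side_count i N)"
      by (rule dvd_prodI) (use length_pos in auto)
    then show "side_count 0 N dvd box_card N" by (simp add: box_card_def)
  qed (rule box_card_pos)
  then show "\<forall>\<^sub>F N in sequentially. real (side_count 0 N) \<le> real (box_card N)" by simp
qed

lemma const_le_box_card:
  assumes "\<epsilon> > 0"
  shows "\<forall>\<^sub>F N in sequentially. b \<le> \<epsilon> * real (box_card N)"
proof -
  have "\<forall>\<^sub>F N in sequentially. b / \<epsilon> \<le> real (box_card N)"
    using box_card_at_top by (simp add: filterlim_at_top)
  then show ?thesis
    by (rule eventually_mono) (use assms in \<open>simp add: field_simps\<close>)
qed

lemma box_card_ratio: "(\<lambda>N. real (box_card (N + M)) / real (box_card N)) \<longlonglongrightarrow> 1"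
proof -
  have "real (box_card (N + M)) / real (box_card N) =
      (\<Prod>i<length \<alpha>s. real (side_count i (N + M)) / real (side_count i N))" for N
    using orders_pos by (auto simp: box_card_def prod_dividef)
  moreover have "(\<lambda>N. \<Prod>i<length \<alpha>s. real (side_count i (N + M)) / real (side_count i N))
      \<longlonglongrightarrow> (\<Prod>i<length \<alpha>s. 1)"
    by (intro tendsto_prod side_count_ratio) simp
  ultimately show ?thesis by simp
qed

text \<open>
  The difference of two concentric boxes has \<open>s_{N+M} - s_N\<close> points, and \<open>s_{N+M} / s_N \<rightarrow> 1\<close>.
\<close>

lemma box_shell_small:
  fixes \<epsilon> :: real
  assumes "\<epsilon> > 0"
  shows "\<forall>\<^sub>F N in sequentially. \<forall>c\<in>G. real (card (ibox (N + M) c - ibox N c)) \<le> \<epsilon> * card (ibox N c)"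
proof -
  have "\<forall>\<^sub>F N in sequentially. real (box_card (N + M)) / real (box_card N) < 1 + \<epsilon>"
    by (rule order_tendstoD(2)[OF box_card_ratio]) (use assms in simp)
  then show ?thesis
    using eventually_ge_at_top[of 2]
  proof eventually_elim
    case (elim N)
    show ?case
    proof
      fix c assume c: "c \<in> G"
      have "real (card (ibox (N + M) c - ibox N c)) = real (box_card (N + M)) - real (box_card N)"
        using elim c box_mono[of N "N + M" c] box_finite_card[of "N + M" c] box_finite_card[of N c]
        by (subst card_Diff_subset) (auto simp: of_nat_diff card_mono dest: card_mono)
      also have "\<dots> \<le> \<epsilon> * real (box_card N)"
        using elim(1) box_card_pos[of N] by (simp add: field_simps)
      finally show "real (card (ibox (N + M) c - ibox N c)) \<le> \<epsilon> * card (ibox N c)"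
        using elim c by (simp add: box_finite_card)
    qed
  qed
qed

end


section \<open>Index maps of finite upper density\<close>

lemma of_nat_divide_ennreal:
  "n > 0 \<Longrightarrow> (of_nat m / of_nat n :: ennreal) = ennreal (real m / real n)"
  by (simp add: divide_ennreal ennreal_of_nat_eq_real_of_nat)

locale indexed_family = index_lattice \<alpha>s ns
  for \<alpha>s :: "real list" and ns :: "nat list" +
  fixes I :: "'i set" and a :: "'i \<Rightarrow> (nat \<Rightarrow> real) \<times> (nat \<Rightarrow> int)"
  assumes a_in_G: "a \<in> I \<rightarrow> carrier (index_group \<alpha>s ns)"
    and finite_upper_density: "upper_density \<alpha>s ns I a < \<infinity>"
begin

abbreviation "ipre \<equiv> pre_box \<alpha>s ns I a"

lemma G_nonempty: "G \<noteq> {}"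
  using group.is_monoid[OF comm_group.axioms(2)[OF comm_group_index_group]] monoid.one_closed
  by blast

lemma ipre_mono: "M \<le> N \<Longrightarrow> ipre M c \<subseteq> ipre N c"
  using box_mono[of M N c] by (auto simp: pre_box_def)

lemma ipre_subset: "ipre N c \<subseteq> I"
  by (auto simp: pre_box_def)

text \<open>
  Fix a single scale \<open>N\<close> at which the box ratios are bounded in all centres. The fibre over \<open>k\<close> lies
  in \<open>I_N(k)\<close>, whose cardinality is at most that bound times \<open>s_N\<close>.
\<close>

lemma fibre_bound:
  obtains C :: nat where "\<And>k. k \<in> G \<Longrightarrow> finite {i \<in> I. a i = k} \<and> card {i \<in> I. a i = k} \<le> C"
proof -
  obtain y where y: "upper_density \<alpha>s ns I a < y" "y < \<infinity>"
    using dense[OF finite_upper_density] by blast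
  have "\<forall>\<^sub>F N in sequentially. (SUP j\<in>G. box_ratio \<alpha>s ns I a N j) < y"
    using y(1) unfolding upper_density_def by (rule Limsup_lessD)
  then obtain N where N: "N \<ge> 2" "(SUP j\<in>G. box_ratio \<alpha>s ns I a N j) < y"
    using eventually_happens[OF eventually_conj[OF _ eventually_ge_at_top[of 2]]] by force
  obtain z where z: "y = ennreal z" "z \<ge> 0" using y(2) by (cases y) auto
  have bound: "finite {i \<in> I. a i = k} \<and> card {i \<in> I. a i = k} \<le> nat \<lceil>z * box_card N\<rceil>"
    if k: "k \<in> G" for k
  proof -
    have "k \<in> ibox N k"
      using N(1) k by (simp add: box_eq)
    then have sub: "{i \<in> I. a i = k} \<subseteq> ipre N k"
      by (auto simp: pre_box_def)
    have "box_ratio \<alpha>s ns I a N k < y"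
      using N(2) k by (meson SUP_upper le_less_trans)
    then have less: "emeasure (count_space UNIV) (ipre N k) / of_nat (box_card N) < ennreal z"
      using N(1) k z by (simp add: box_ratio_def box_finite_card emeasure_count_space)
    have fin: "finite (ipre N k)"
    proof (rule ccontr)
      assume "infinite (ipre N k)"
      then show False using less
        by (simp add: emeasure_count_space ennreal_top_divide)
    qed
    have "ennreal (card (ipre N k) / box_card N) < ennreal z"
      using less fin box_card_pos[of N]
      by (simp add: emeasure_count_space of_nat_divide_ennreal)
    then have "card (ipre N k) \<le> z * box_card N"
      using z(2) box_card_pos[of N] by (simp add: ennreal_less_iff field_simps)
    then have "card (ipre N k) \<le> nat \<lceil>z * box_card N\<rceil>"
      by linarith
    then show ?thesis
      using card_mono[OF fin sub] finite_subset[OF sub fin] by linarith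
  qed
  show ?thesis by (rule that) (rule bound)
qed

lemma preimage_bound:
  obtains C :: nat where "\<And>S. finite S \<Longrightarrow> S \<subseteq> G \<Longrightarrow> finite {i \<in> I. a i \<in> S}"
    and "\<And>S. finite S \<Longrightarrow> S \<subseteq> G \<Longrightarrow> card {i \<in> I. a i \<in> S} \<le> C * card S"
proof -
  obtain C where C: "\<And>k. k \<in> G \<Longrightarrow> finite {i \<in> I. a i = k} \<and> card {i \<in> I. a i = k} \<le> C"
    by (rule fibre_bound) blast
  have eq: "{i \<in> I. a i \<in> S} = (\<Union>k\<in>S. {i \<in> I. a i = k})" for S by auto
  show ?thesis
  proof
    fix S assume S: "finite S" "S \<subseteq> G"
    then show "finite {i \<in> I. a i \<in> S}" unfolding eq using C by auto
    have "card {i \<in> I. a i \<in> S} \<le> (\<Sum>k\<in>S. card {i \<in> I. a i = k})"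
      unfolding eq by (rule card_UN_le) (rule S(1))
    also have "\<dots> \<le> (\<Sum>k\<in>S. C)" using C S(2) by (intro sum_mono) auto
    finally show "card {i \<in> I. a i \<in> S} \<le> C * card S" by (simp add: mult.commute)
  qed
qed

lemma finite_ipre:
  assumes "N \<ge> 2" "c \<in> G"
  shows "finite (ipre N c)"
proof -
  obtain C where "\<And>S. finite S \<Longrightarrow> S \<subseteq> G \<Longrightarrow> finite {i \<in> I. a i \<in> S}"
    by (rule preimage_bound) blast
  from this[OF box_finite_card(1)[OF assms] box_subset_G] show ?thesis
    by (simp add: pre_box_def)
qed

lemma ipre_card_bound:
  obtains C :: real where "C > 0" and
    "\<And>N c. N \<ge> 2 \<Longrightarrow> c \<in> G \<Longrightarrow> real (card (ipre N c)) \<le> C * card (ibox N c)"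
proof -
  obtain C where C: "\<And>S. finite S \<Longrightarrow> S \<subseteq> G \<Longrightarrow> card {i \<in> I. a i \<in> S} \<le> C * card S"
    by (rule preimage_bound) blast
  show ?thesis
  proof (rule that[of "real C + 1"])
    fix N c assume "(N::nat) \<ge> 2" "c \<in> G"
    from C[OF box_finite_card(1)[OF this] box_subset_G]
    have "card (ipre N c) \<le> C * card (ibox N c)"
      by (simp add: pre_box_def)
    also have "\<dots> \<le> (C + 1) * card (ibox N c)" by simp
    finally show "real (card (ipre N c)) \<le> (real C + 1) * card (ibox N c)"
      by (drule_tac of_nat_mono[where 'a=real]) (simp add: algebra_simps)
  qed simp
qed

text \<open>
  The preimage of the shell between two concentric boxes is at most as large as the shell, up to the
  bound on the fibres.
\<close>

lemma ipre_shell_small: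
  fixes \<epsilon> :: real
  assumes "\<epsilon> > 0"
  shows "\<forall>\<^sub>F N in sequentially. \<forall>c\<in>G. real (card (ipre (N + M) c - ipre N c)) \<le> \<epsilon> * card (ibox N c)"
proof -
  obtain C where C: "\<And>S. finite S \<Longrightarrow> S \<subseteq> G \<Longrightarrow> card {i \<in> I. a i \<in> S} \<le> C * card S"
    by (rule preimage_bound) blast
  have "\<epsilon> / (C + 1) > 0" using assms by simp
  from box_shell_small[OF this, of M] eventually_ge_at_top[of 2] show ?thesis
  proof eventually_elim
    case (elim N)
    show ?case
    proof
      fix c assume c: "c \<in> G"
      have "finite (ibox (N + M) c - ibox N c)" "ibox (N + M) c - ibox N c \<subseteq> G"
        using elim(2) c box_finite_card(1)[of "N + M" c] box_subset_G[of "N + M" c]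
        by (simp_all add: Diff_subset[THEN order_trans])
      from C[OF this] have "card (ipre (N + M) c - ipre N c) \<le> C * card (ibox (N + M) c - ibox N c)"
        by (rule order_trans[rotated]) (simp add: pre_box_def set_diff_eq conj_comms cong: conj_cong)
      also have "\<dots> \<le> (C + 1) * card (ibox (N + M) c - ibox N c)" by simp
      finally have "real (card (ipre (N + M) c - ipre N c)) \<le>
          (real C + 1) * card (ibox (N + M) c - ibox N c)"
        by (drule_tac of_nat_mono[where 'a=real]) (simp add: algebra_simps)
      also have "\<dots> \<le> (real C + 1) * (\<epsilon> / (C + 1) * card (ibox N c))"
        using elim(1) c by (intro mult_left_mono) auto
      also have "\<dots> = \<epsilon> * card (ibox N c)" by (simp add: field_simps)
      finally show "real (card (ipre (N + M) c - ipre N c)) \<le> \<epsilon> * card (ibox N c)" .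
    qed
  qed
qed

lemma box_ratio_eq:
  assumes "N \<ge> 2" "c \<in> G"
  shows "box_ratio \<alpha>s ns I a N c = ennreal (card (ipre N c) / box_card N)"
  using box_finite_card[OF assms] finite_ipre[OF assms] box_card_pos[of N]
  by (simp add: box_ratio_def emeasure_count_space of_nat_divide_ennreal)

lemma lower_density_le_upper_density: "lower_density \<alpha>s ns I a \<le> upper_density \<alpha>s ns I a"
proof -
  have "lower_density \<alpha>s ns I a \<le> liminf (\<lambda>N. SUP j\<in>G. box_ratio \<alpha>s ns I a N j)"
    unfolding lower_density_def by (intro Liminf_mono always_eventually allI INF_le_SUP G_nonempty)
  also have "\<dots> \<le> upper_density \<alpha>s ns I a"
    unfolding upper_density_def by (intro Liminf_le_Limsup) simp
  finally show ?thesis .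
qed

end


section \<open>Comparison of norm sums over boxes\<close>

locale decaying_frame_pair =
  separable_hilbert_space scale ip + indexed_family \<alpha>s ns I a
  for scale :: "'k::hilbert_scalar \<Rightarrow> 'h::banach \<Rightarrow> 'h" and ip :: "'h \<Rightarrow> 'h \<Rightarrow> 'k"
    and \<alpha>s :: "real list" and ns :: "nat list"
    and I :: "'i set" and a :: "'i \<Rightarrow> (nat \<Rightarrow> real) \<times> (nat \<Rightarrow> int)" +
  fixes f :: "'i \<Rightarrow> 'h" and e :: "(nat \<Rightarrow> real) \<times> (nat \<Rightarrow> int) \<Rightarrow> 'h"
    and A B E F :: real
  assumes f_frame: "is_frame ip f I A B"
    and e_frame: "is_frame ip e (carrier (index_group \<alpha>s ns)) E F"
    and column_decay: "l2_column_decay \<alpha>s ns ip f I a e"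
    and row_decay: "l2_row_decay \<alpha>s ns ip f I a e"
begin

lemma bounds_pos: "A > 0" "B > 0" "E > 0" "F > 0"
  using f_frame e_frame by (simp_all add: is_frame_def)

lemma e_bounds: "j \<in> G \<Longrightarrow> (norm (e j))\<^sup>2 \<le> F"
  by (rule frame_norm_bound[OF e_frame])

lemma f_bounds: "i \<in> I \<Longrightarrow> (norm (f i))\<^sup>2 \<le> B"
  by (rule frame_norm_bound[OF f_frame])

abbreviation "e_sum N c \<equiv> \<Sum>j\<in>ibox N c. (norm (e j))\<^sup>2"
abbreviation "f_sum N c \<equiv> \<Sum>i\<in>ipre N c. (norm (f i))\<^sup>2"

lemma e_sum_shell:
  assumes "N \<ge> 2" "c \<in> G"
  shows "e_sum (N + M) c \<le> e_sum N c + F * card (ibox (N + M) c - ibox N c)"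
proof -
  have "e_sum (N + M) c = e_sum N c + (\<Sum>j\<in>ibox (N + M) c - ibox N c. (norm (e j))\<^sup>2)"
    using box_finite_card(1)[of "N + M" c] assms box_mono[of N "N + M" c]
    by (subst sum.subset_diff[of "ibox N c"]) auto
  also have "(\<Sum>j\<in>ibox (N + M) c - ibox N c. (norm (e j))\<^sup>2) \<le>
      of_nat (card (ibox (N + M) c - ibox N c)) * F"
    by (rule sum_bounded_above) (use e_bounds box_subset_G in blast)
  finally show ?thesis by (simp add: mult.commute)
qed

lemma f_sum_shell:
  assumes "N \<ge> 2" "c \<in> G"
  shows "f_sum (N + M) c \<le> f_sum N c + B * card (ipre (N + M) c - ipre N c)"
proof -
  have "f_sum (N + M) c = f_sum N c + (\<Sum>i\<in>ipre (N + M) c - ipre N c. (norm (f i))\<^sup>2)"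
    using finite_ipre[of "N + M" c] assms ipre_mono[of N "N + M" c]
    by (subst sum.subset_diff[of "ipre N c"]) auto
  also have "(\<Sum>i\<in>ipre (N + M) c - ipre N c. (norm (f i))\<^sup>2) \<le>
      of_nat (card (ipre (N + M) c - ipre N c)) * B"
    by (rule sum_bounded_above) (use f_bounds ipre_subset in blast)
  finally show ?thesis by (simp add: mult.commute)
qed

text \<open>
  Double counting with \<open>P = S_N(c)\<close> and \<open>Q = I_{N+M}(c)\<close>, where \<open>M\<close> comes from column decay: for
  \<open>j \<in> S_N(c)\<close> the box \<open>S_M(j)\<close> lies in \<open>S_{N+M}(c)\<close>, so the tail outside \<open>Q\<close> is part of the tail
  outside \<open>I_M(j)\<close>. One half of \<open>\<epsilon>\<close> pays for this tail and the other one for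
  \<open>I_{N+M}(c) - I_N(c)\<close>.
\<close>

lemma e_sum_le_f_sum:
  fixes \<epsilon> :: real
  assumes "\<epsilon> > 0"
  shows "\<forall>\<^sub>F N in sequentially. \<forall>c\<in>G. A * e_sum N c \<le> F * f_sum N c + \<epsilon> * card (ibox N c)"
proof -
  have "\<epsilon> / 2 > 0" using assms by simp
  then obtain M0 where M0: "\<And>j. j \<in> G \<Longrightarrow>
      (\<Sum>\<^sub>\<infinity>i\<in>I - ipre M0 j. ennreal ((norm (ip (f i) (e j)))\<^sup>2)) < ennreal (\<epsilon> / 2)"
    using column_decay unfolding l2_column_decay_def by meson
  \<comment> \<open>boxes of parameter at least 2 obey the triangle inequality by their lattice coordinates alone\<close>
  define M where "M = M0 + 2"
  have "\<epsilon> / (2 * F * B) > 0" using assms bounds_pos by simp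
  from ipre_shell_small[OF this, of M] eventually_ge_at_top[of 2] show ?thesis
  proof eventually_elim
    case (elim N)
    show ?case
    proof
      fix c assume c: "c \<in> G"
      have tail: "(\<Sum>\<^sub>\<infinity>i\<in>I - ipre (N + M) c. ennreal ((norm (ip (e j) (f i)))\<^sup>2)) \<le> ennreal (\<epsilon> / 2)"
        if j: "j \<in> ibox N c" for j
      proof -
        have jG: "j \<in> G" using j box_subset_G by blast
        have "ibox M0 j \<subseteq> ibox (N + M) c"
          using box_mono[of M0 M j] box_triangle[of M N c j] elim(2) c j by (simp add: M_def)
        then have "I - ipre (N + M) c \<subseteq> I - ipre M0 j"
          by (auto simp: pre_box_def)
        then have "(\<Sum>\<^sub>\<infinity>i\<in>I - ipre (N + M) c. ennreal ((norm (ip (f i) (e j)))\<^sup>2)) \<le> ennreal (\<epsilon> / 2)"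
          using infsum_ennreal_mono_set M0[OF jG] by (meson le_less_trans less_imp_le)
        then show ?thesis by (simp add: norm_ip_commute[of "e j"])
      qed
      have "A * e_sum N c \<le> F * f_sum (N + M) c + \<epsilon> / 2 * card (ibox N c)"
        using elim(2) c assms box_finite_card(1)[of N c] finite_ipre[of "N + M" c]
        by (intro frame_double_counting[OF f_frame e_frame] box_subset_G ipre_subset tail) auto
      also have "F * f_sum (N + M) c \<le> F * (f_sum N c + B * (\<epsilon> / (2 * F * B) * card (ibox N c)))"
      proof (rule mult_left_mono)
        have "B * card (ipre (N + M) c - ipre N c) \<le> B * (\<epsilon> / (2 * F * B) * card (ibox N c))"
          using elim(1) c bounds_pos by (intro mult_left_mono) auto
        with f_sum_shell[OF elim(2) c, of M]
        show "f_sum (N + M) c \<le> f_sum N c + B * (\<epsilon> / (2 * F * B) * card (ibox N c))" by linarith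
      qed (use bounds_pos in simp)
      also have "\<dots> = F * f_sum N c + \<epsilon> / 2 * card (ibox N c)"
        using bounds_pos by (simp add: field_simps)
      finally show "A * e_sum N c \<le> F * f_sum N c + \<epsilon> * card (ibox N c)"
        by (simp add: field_simps)
    qed
  qed
qed

text \<open>
  The mirror image, with \<open>P = I_N(c)\<close>, \<open>Q = S_{N+M}(c)\<close> and row decay. The error is now proportional to
  \<open>|I_N(c)|\<close>, which is at most a constant times \<open>s_N\<close>; hence the tail \<open>\<delta>\<close>.
\<close>

lemma f_sum_le_e_sum:
  fixes \<epsilon> :: real
  assumes "\<epsilon> > 0"
  shows "\<forall>\<^sub>F N in sequentially. \<forall>c\<in>G. E * f_sum N c \<le> B * e_sum N c + \<epsilon> * card (ibox N c)"
proof -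
  obtain C :: real where C: "C > 0"
    "\<And>N c. N \<ge> 2 \<Longrightarrow> c \<in> G \<Longrightarrow> real (card (ipre N c)) \<le> C * card (ibox N c)"
    by (rule ipre_card_bound) (rule that)
  define \<delta> where "\<delta> = \<epsilon> / (2 * C)"
  have \<delta>: "\<delta> > 0" using assms C(1) by (simp add: \<delta>_def)
  then obtain M0 where M0: "\<And>i. i \<in> I \<Longrightarrow>
      (\<Sum>\<^sub>\<infinity>j\<in>G - ibox M0 (a i). ennreal ((norm (ip (f i) (e j)))\<^sup>2)) < ennreal \<delta>"
    using row_decay unfolding l2_row_decay_def by meson
  \<comment> \<open>boxes of parameter at least 2 obey the triangle inequality by their lattice coordinates alone\<close>
  define M where "M = M0 + 2"
  have "\<epsilon> / (2 * F * B) > 0" using assms bounds_pos by simp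
  from box_shell_small[OF this, of M] eventually_ge_at_top[of 2] show ?thesis
  proof eventually_elim
    case (elim N)
    show ?case
    proof
      fix c assume c: "c \<in> G"
      have tail: "(\<Sum>\<^sub>\<infinity>j\<in>G - ibox (N + M) c. ennreal ((norm (ip (f i) (e j)))\<^sup>2)) \<le> ennreal \<delta>"
        if i: "i \<in> ipre N c" for i
      proof -
        have i': "i \<in> I" "a i \<in> ibox N c" using i by (auto simp: pre_box_def)
        have "ibox M0 (a i) \<subseteq> ibox (N + M) c"
          using box_mono[of M0 M "a i"] box_triangle[of M N c "a i"] elim(2) c i'(2)
          by (simp add: M_def)
        then have "G - ibox (N + M) c \<subseteq> G - ibox M0 (a i)"
          by auto
        then show ?thesis
          using infsum_ennreal_mono_set M0[OF i'(1)] by (meson le_less_trans less_imp_le)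
      qed
      have "E * f_sum N c \<le> B * e_sum (N + M) c + \<delta> * card (ipre N c)"
        using elim(2) c \<delta> box_finite_card(1)[of "N + M" c] finite_ipre[of N c]
        by (intro frame_double_counting[OF e_frame f_frame] box_subset_G ipre_subset tail) auto
      also have "\<delta> * card (ipre N c) \<le> \<delta> * (C * card (ibox N c))"
        using C(2)[OF elim(2) c] \<delta> by (intro mult_left_mono) auto
      also have "\<delta> * (C * card (ibox N c)) = \<epsilon> / 2 * card (ibox N c)"
        using C(1) by (simp add: \<delta>_def)
      also have "B * e_sum (N + M) c \<le> B * (e_sum N c + F * (\<epsilon> / (2 * F * B) * card (ibox N c)))"
      proof (rule mult_left_mono)
        have "F * card (ibox (N + M) c - ibox N c) \<le> F * (\<epsilon> / (2 * F * B) * card (ibox N c))"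
          using elim(1) c bounds_pos by (intro mult_left_mono) auto
        with e_sum_shell[OF elim(2) c, of M]
        show "e_sum (N + M) c \<le> e_sum N c + F * (\<epsilon> / (2 * F * B) * card (ibox N c))" by linarith
      qed (use bounds_pos in simp)
      also have "B * (e_sum N c + F * (\<epsilon> / (2 * F * B) * card (ibox N c))) =
          B * e_sum N c + \<epsilon> / 2 * card (ibox N c)"
        using bounds_pos by (simp add: field_simps)
      finally show "E * f_sum N c \<le> B * e_sum N c + \<epsilon> * card (ibox N c)"
        by (simp add: field_simps)
    qed
  qed
qed

end


section \<open>Limits along ultrafilters, and averages over boxes\<close>

text \<open>
  A number strictly between the lower and the upper limit would separate the values of \<open>g\<close> into two
  sets, one of which belongs to the ultrafilter and bounds the lower limit from below or the upper one
  from above.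
\<close>

lemma tendsto_Lim_ultrafilter:
  fixes g :: "nat \<Rightarrow> ennreal"
  assumes "free_ultrafilter p"
  shows "(g \<longlongrightarrow> Lim p g) p"
proof -
  have p: "p \<noteq> bot" "\<And>P. eventually P p \<or> eventually (\<lambda>N. \<not> P N) p"
    using assms by (auto simp: free_ultrafilter_def)
  have "\<not> Liminf p g < Limsup p g"
  proof
    assume "Liminf p g < Limsup p g"
    then obtain y where y: "Liminf p g < y" "y < Limsup p g"
      using dense by blast
    from p(2)[of "\<lambda>N. y \<le> g N"] show False
    proof
      assume "\<forall>\<^sub>F N in p. y \<le> g N"
      then show False using Liminf_bounded[of y g p] y(1) by (simp add: not_less[symmetric])
    next
      assume "\<forall>\<^sub>F N in p. \<not> y \<le> g N"
      then have "\<forall>\<^sub>F N in p. g N \<le> y" by (rule eventually_mono) simp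
      then show False using Limsup_bounded[of g y p] y(2) by (simp add: not_less[symmetric])
    qed
  qed
  then have "Liminf p g = Limsup p g"
    using Liminf_le_Limsup[OF p(1), of g] by (simp add: antisym)
  then have "(g \<longlongrightarrow> Limsup p g) p"
    using Liminf_eq_Limsup[OF p(1)] by blast
  then show ?thesis
    using tendsto_Lim[OF p(1)] by fastforce
qed

lemma free_ultrafilter_le_sequentially:
  assumes "free_ultrafilter p"
  shows "p \<le> sequentially"
proof (rule filter_leI)
  fix P :: "nat \<Rightarrow> bool" assume "eventually P sequentially"
  then have "finite {N. \<not> P N}"
    by (simp add: cofinite_eq_sequentially[symmetric] eventually_cofinite)
  then show "eventually P p"
    using assms unfolding free_ultrafilter_def by blast
qed

lemma average_on_le:
  assumes "\<And>s. s \<in> S \<Longrightarrow> x s \<le> b" "b \<ge> 0"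
  shows "average_on S x \<le> ennreal b"
proof -
  have "(\<Sum>s\<in>S. x s) / real (card S) \<le> b"
    using sum_bounded_above[of S x b] assms
    by (cases "card S = 0") (auto simp: field_simps)
  then show ?thesis by (simp add: average_on_def ennreal_leI)
qed

lemma ennreal_cross_divide:
  fixes x y :: ennreal
  assumes "ennreal r * x \<le> ennreal s * y" "r > 0" "s > 0"
  shows "ennreal (1 / s) * x \<le> ennreal (1 / r) * y"
proof -
  have "ennreal (1 / s) * x = ennreal (1 / (r * s)) * (ennreal r * x)"
    using assms by (simp add: mult.assoc[symmetric] flip: ennreal_mult)
  also have "\<dots> \<le> ennreal (1 / (r * s)) * (ennreal s * y)"
    using assms(1) by (rule mult_left_mono) simp
  also have "\<dots> = ennreal (1 / r) * y"
    using assms by (simp add: mult.assoc[symmetric] flip: ennreal_mult)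
  finally show ?thesis .
qed

context decaying_frame_pair
begin

text \<open>
  The product of \<open>|I_N(c)| / s_N\<close> with the average over \<open>I_N(c)\<close> is the \<open>f\<close>-sum divided by \<open>s_N\<close>, also if
  \<open>I_N(c)\<close> is empty. Its limit is the product of the two limits because both are finite; in \<open>[0, \<infinity>]\<close>
  multiplication is not continuous at \<open>(0, \<infinity>)\<close>.
\<close>

lemma averages_along_ultrafilter:
  assumes p: "free_ultrafilter p" and c: "\<And>N. c N \<in> G"
  defines "X \<equiv> Lim p (\<lambda>N. average_on (ibox N (c N)) (\<lambda>j. (norm (e j))\<^sup>2))"
    and "Y \<equiv> Lim p (\<lambda>N. average_on (ipre N (c N)) (\<lambda>i. (norm (f i))\<^sup>2))"
    and "D \<equiv> density_along \<alpha>s ns I a p c"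
  shows "ennreal A * X \<le> ennreal F * (D * Y)" and "ennreal E * (D * Y) \<le> ennreal B * X"
proof -
  have p_bot: "p \<noteq> bot" using p by (simp add: free_ultrafilter_def)
  note ev = filter_leD[OF free_ultrafilter_le_sequentially[OF p]]
  let ?x = "\<lambda>N. average_on (ibox N (c N)) (\<lambda>j. (norm (e j))\<^sup>2)"
  let ?y = "\<lambda>N. average_on (ipre N (c N)) (\<lambda>i. (norm (f i))\<^sup>2)"
  let ?r = "\<lambda>N. box_ratio \<alpha>s ns I a N (c N)"
  have x: "(?x \<longlongrightarrow> X) p" and y: "(?y \<longlongrightarrow> Y) p" and r: "(?r \<longlongrightarrow> D) p"
    unfolding X_def Y_def D_def density_along_def by (rule tendsto_Lim_ultrafilter[OF p])+
  have ge2: "\<forall>\<^sub>F N in p. N \<ge> 2"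
    by (rule ev) (rule eventually_ge_at_top)
  have Y: "Y < \<infinity>"
  proof -
    have "\<forall>\<^sub>F N in p. ?y N \<le> ennreal B"
      using bounds_pos
      by (intro always_eventually allI average_on_le f_bounds ipre_subset[THEN subsetD]) auto
    then have "Y \<le> ennreal B" using y p_bot by (intro tendsto_upperbound)
    then show ?thesis by (simp add: le_less_trans)
  qed
  have D: "D < \<infinity>"
  proof -
    obtain C :: real where C: "C > 0"
      "\<And>N c. N \<ge> 2 \<Longrightarrow> c \<in> G \<Longrightarrow> real (card (ipre N c)) \<le> C * card (ibox N c)"
      by (rule ipre_card_bound) (rule that)
    have "\<forall>\<^sub>F N in p. ?r N \<le> ennreal C"
      using ge2
    proof eventually_elim
      case (elim N)
      have "card (ipre N (c N)) / box_card N \<le> C"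
        using C(2)[OF elim c, of N] box_finite_card(2)[OF elim c, of N] box_card_pos[of N]
        by (simp add: field_simps)
      then show ?case using box_ratio_eq[OF elim c] by (simp add: ennreal_leI)
    qed
    then have "D \<le> ennreal C" using r p_bot by (intro tendsto_upperbound)
    then show ?thesis by (simp add: le_less_trans)
  qed
  have ry: "((\<lambda>N. ?r N * ?y N) \<longlongrightarrow> D * Y) p"
    using r y D Y by (intro tendsto_mult_ennreal) auto
  have eqs: "?x N = ennreal (e_sum N (c N) / box_card N)"
    "?r N * ?y N = ennreal (f_sum N (c N) / box_card N)" if N: "N \<ge> 2" for N
  proof -
    show "?x N = ennreal (e_sum N (c N) / box_card N)"
      using box_finite_card[OF N c] by (simp add: average_on_def)
    show "?r N * ?y N = ennreal (f_sum N (c N) / box_card N)"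
      using finite_ipre[OF N c, of N]
      by (cases "ipre N (c N) = {}")
        (auto simp: box_ratio_eq[OF N c] average_on_def sum_nonneg simp flip: ennreal_mult)
  qed
  show "ennreal A * X \<le> ennreal F * (D * Y)"
  proof (rule ennreal_le_epsilon)
    fix \<epsilon> :: real assume "\<epsilon> > 0"
    have "\<forall>\<^sub>F N in p. ennreal A * ?x N \<le> ennreal F * (?r N * ?y N) + ennreal \<epsilon>"
      using ge2 ev[OF e_sum_le_f_sum[OF \<open>\<epsilon> > 0\<close>]]
    proof eventually_elim
      case (elim N)
      have "A * (e_sum N (c N) / box_card N) \<le> F * (f_sum N (c N) / box_card N) + \<epsilon>"
        using bspec[OF elim(2) c[of N]] box_finite_card(2)[OF elim(1) c, of N] box_card_pos[of N]
        by (simp add: field_simps)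
      then have "ennreal (A * (e_sum N (c N) / box_card N)) \<le>
          ennreal (F * (f_sum N (c N) / box_card N) + \<epsilon>)"
        by (rule ennreal_leI)
      then show ?case
        using bounds_pos \<open>\<epsilon> > 0\<close> by (simp only: eqs[OF elim(1)])
          (simp add: sum_nonneg flip: ennreal_mult')
    qed
    then show "ennreal A * X \<le> ennreal F * (D * Y) + ennreal \<epsilon>"
      by (rule tendsto_le[OF p_bot tendsto_add[OF ennreal_tendsto_cmult[OF _ ry] tendsto_const]
          ennreal_tendsto_cmult[OF _ x], rotated 2]) simp_all
  qed
  show "ennreal E * (D * Y) \<le> ennreal B * X"
  proof (rule ennreal_le_epsilon)
    fix \<epsilon> :: real assume "\<epsilon> > 0"
    have "\<forall>\<^sub>F N in p. ennreal E * (?r N * ?y N) \<le> ennreal B * ?x N + ennreal \<epsilon>"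
      using ge2 ev[OF f_sum_le_e_sum[OF \<open>\<epsilon> > 0\<close>]]
    proof eventually_elim
      case (elim N)
      have "E * (f_sum N (c N) / box_card N) \<le> B * (e_sum N (c N) / box_card N) + \<epsilon>"
        using bspec[OF elim(2) c[of N]] box_finite_card(2)[OF elim(1) c, of N] box_card_pos[of N]
        by (simp add: field_simps)
      then have "ennreal (E * (f_sum N (c N) / box_card N)) \<le>
          ennreal (B * (e_sum N (c N) / box_card N) + \<epsilon>)"
        by (rule ennreal_leI)
      then show ?case
        using bounds_pos \<open>\<epsilon> > 0\<close> by (simp only: eqs[OF elim(1)])
          (simp add: sum_nonneg flip: ennreal_mult')
    qed
    then show "ennreal E * (D * Y) \<le> ennreal B * X + ennreal \<epsilon>"
      by (rule tendsto_le[OF p_bot tendsto_add[OF ennreal_tendsto_cmult[OF _ x] tendsto_const]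
          ennreal_tendsto_cmult[OF _ ry], rotated 2]) simp_all
  qed
qed

end


section \<open>Density bounds from bounds on the norms\<close>

lemma le_ennrealI_dense:
  assumes "\<And>m. m \<ge> 0 \<Longrightarrow> ennreal m < X \<Longrightarrow> ennreal m \<le> Y"
  shows "X \<le> Y"
proof (rule dense_le)
  fix y assume "y < X"
  then show "y \<le> Y" using assms by (cases y) auto
qed

lemma le_mult_approx_above:
  fixes x s l :: real
  assumes "\<And>K. K > s \<Longrightarrow> x \<le> K * l"
  shows "x \<le> s * l"
proof (rule tendsto_lowerbound)
  show "((\<lambda>K. K * l) \<longlongrightarrow> s * l) (at_right s)"
    by (intro tendsto_intros)
  show "\<forall>\<^sub>F K in at_right s. x \<le> K * l"
    using eventually_at_right_less[of s] by (rule eventually_mono) (rule assms)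
qed simp

lemma finite_below_liminf_on:
  assumes "ennreal m < liminf_on S x"
  shows "finite {s \<in> S. \<not> m \<le> x s}"
proof -
  have "\<forall>\<^sub>F s in inf cofinite (principal S). ennreal m < ennreal (x s)"
    using assms unfolding liminf_on_def by (rule less_LiminfD)
  then have "finite {s. \<not> (s \<in> S \<longrightarrow> ennreal m < ennreal (x s))}"
    by (simp add: eventually_inf_principal eventually_cofinite)
  then show ?thesis
    by (rule rev_finite_subset) (auto simp: not_le not_less intro: ennreal_leI)
qed

lemma finite_above_limsup_on:
  assumes "limsup_on S x < ennreal K"
  shows "finite {s \<in> S. \<not> x s \<le> K}"
proof -
  have "\<forall>\<^sub>F s in inf cofinite (principal S). ennreal (x s) < ennreal K"
    using assms unfolding limsup_on_def by (rule Limsup_lessD)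
  then have "finite {s. \<not> (s \<in> S \<longrightarrow> ennreal (x s) < ennreal K)}"
    by (simp add: eventually_inf_principal eventually_cofinite)
  then show ?thesis
    by (rule rev_finite_subset) (auto simp: not_le not_less intro: ennreal_leI)
qed

lemma limsup_on_le:
  assumes "\<And>s. s \<in> S \<Longrightarrow> x s \<le> b"
  shows "limsup_on S x \<le> ennreal b"
  unfolding limsup_on_def
  by (rule Limsup_bounded) (auto simp: eventually_inf_principal assms intro!: ennreal_leI always_eventually)

lemma sum_ge_outside_finite:
  fixes x :: "'s \<Rightarrow> real"
  assumes "finite S" "S \<subseteq> U" "finite {s \<in> U. \<not> m \<le> x s}" "\<And>s. x s \<ge> 0" "m \<ge> 0"
  shows "m * card S - m * card {s \<in> U. \<not> m \<le> x s} \<le> (\<Sum>s\<in>S. x s)"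
proof -
  let ?Z = "{s \<in> U. \<not> m \<le> x s}"
  have "card S \<le> card (S - ?Z) + card ?Z"
    using card_Un_le[of "S - ?Z" ?Z] card_mono[of "S - ?Z \<union> ?Z" S] assms by auto
  then have "real (card S) - card ?Z \<le> card (S - ?Z)" by linarith
  then have "m * (real (card S) - card ?Z) \<le> m * card (S - ?Z)"
    using assms(5) by (rule mult_left_mono)
  also have "\<dots> \<le> (\<Sum>s\<in>S - ?Z. x s)"
    using assms(2) by (subst mult.commute) (intro sum_bounded_below, auto)
  also have "\<dots> \<le> (\<Sum>s\<in>S. x s)"
    using assms by (intro sum_mono2) auto
  finally show ?thesis by (simp add: algebra_simps)
qed

lemma sum_le_outside_finite:
  fixes x :: "'s \<Rightarrow> real"
  assumes "finite S" "S \<subseteq> U" "finite {s \<in> U. \<not> x s \<le> K}" "\<And>s. s \<in> U \<Longrightarrow> x s \<le> b" "K \<ge> 0" "b \<ge> 0"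
  shows "(\<Sum>s\<in>S. x s) \<le> K * card S + b * card {s \<in> U. \<not> x s \<le> K}"
proof -
  let ?Z = "{s \<in> U. \<not> x s \<le> K}"
  have "(\<Sum>s\<in>S. x s) \<le> (\<Sum>s\<in>S. K + (if s \<in> ?Z then b else 0))"
    using assms by (intro sum_mono) force
  also have "\<dots> = K * card S + b * card (S \<inter> ?Z)"
    using assms(1) by (simp add: sum.distrib sum.If_cases)
  also have "b * card (S \<inter> ?Z) \<le> b * card ?Z"
    using assms by (intro mult_left_mono) (auto intro!: card_mono)
  finally show ?thesis by simp
qed

context decaying_frame_pair
begin

text \<open>
  Each side of the comparison of box sums is changed by at most a constant, \<open>z\<close> in total, when the
  exceptional vectors are ignored, and \<open>z \<le> (\<epsilon> / 2) s_N\<close> for large \<open>N\<close>. If \<open>K = 0\<close>, the resulting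
  inequality says nothing about the density, but it forces \<open>m = 0\<close>.
\<close>

lemma lower_density_bound:
  assumes m: "m \<ge> 0" "finite {j \<in> G. \<not> m \<le> (norm (e j))\<^sup>2}"
    and K: "K \<ge> 0" "finite {i \<in> I. \<not> (norm (f i))\<^sup>2 \<le> K}"
  shows "ennreal (A * m) \<le> ennreal (F * K) * lower_density \<alpha>s ns I a"
proof (rule ennreal_le_epsilon)
  fix \<epsilon> :: real assume \<epsilon>: "\<epsilon> > 0"
  define z where "z = A * m * card {j \<in> G. \<not> m \<le> (norm (e j))\<^sup>2} +
    F * B * card {i \<in> I. \<not> (norm (f i))\<^sup>2 \<le> K}"
  have *: "\<epsilon> / 2 > 0" using \<epsilon> by simp
  have ev: "\<forall>\<^sub>F N in sequentially. \<forall>c\<in>G. A * m \<le> F * K * (card (ipre N c) / box_card N) + \<epsilon>"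
    using e_sum_le_f_sum[OF *] const_le_box_card[OF *, of z] eventually_ge_at_top[of 2]
  proof eventually_elim
    case (elim N)
    show ?case
    proof
      fix c assume c: "c \<in> G"
      note S = box_finite_card[OF elim(3) c] finite_ipre[OF elim(3) c]
      have "A * (m * card (ibox N c) - m * card {j \<in> G. \<not> m \<le> (norm (e j))\<^sup>2}) \<le> A * e_sum N c"
        using bounds_pos S m box_subset_G
        by (intro mult_left_mono sum_ge_outside_finite) auto
      also have "\<dots> \<le> F * f_sum N c + \<epsilon> / 2 * card (ibox N c)"
        using elim(1) c by blast
      also have "F * f_sum N c \<le>
          F * (K * card (ipre N c) + B * card {i \<in> I. \<not> (norm (f i))\<^sup>2 \<le> K})"
        using bounds_pos S K ipre_subset f_bounds
        by (intro mult_left_mono sum_le_outside_finite) auto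
      finally have "A * m * box_card N \<le> F * K * card (ipre N c) + z + \<epsilon> / 2 * box_card N"
        using S by (simp add: z_def algebra_simps)
      then have "A * m * box_card N \<le> F * K * card (ipre N c) + \<epsilon> * box_card N"
        using elim(2) by linarith
      then show "A * m \<le> F * K * (card (ipre N c) / box_card N) + \<epsilon>"
        using box_card_pos[of N] by (simp add: field_simps)
    qed
  qed
  show "ennreal (A * m) \<le> ennreal (F * K) * lower_density \<alpha>s ns I a + ennreal \<epsilon>"
  proof (cases "K = 0")
    case True
    obtain N where N: "\<forall>c\<in>G. A * m \<le> F * K * (card (ipre N c) / box_card N) + \<epsilon>"
      using eventually_happens[OF ev] by auto
    then have "A * m \<le> \<epsilon>" using True G_nonempty by auto
    then show ?thesis by (simp add: ennreal_leI True)
  next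
    case False
    then have FK: "F * K > 0" using K bounds_pos by simp
    have "ennreal ((A * m - \<epsilon>) / (F * K)) \<le> lower_density \<alpha>s ns I a"
      unfolding lower_density_def
    proof (rule Liminf_bounded)
      show "\<forall>\<^sub>F N in sequentially. ennreal ((A * m - \<epsilon>) / (F * K)) \<le> (INF j\<in>G. box_ratio \<alpha>s ns I a N j)"
        using ev eventually_ge_at_top[of 2]
      proof eventually_elim
        case (elim N)
        show ?case
        proof (rule INF_greatest)
          fix c assume c: "c \<in> G"
          have "(A * m - \<epsilon>) / (F * K) \<le> card (ipre N c) / box_card N"
            using elim(1) c FK by (simp add: pos_divide_le_eq mult.commute) (smt (verit))
          then show "ennreal ((A * m - \<epsilon>) / (F * K)) \<le> box_ratio \<alpha>s ns I a N c"
            by (simp add: box_ratio_eq elim(2) c ennreal_leI)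
        qed
      qed
    qed
    then have "ennreal (F * K) * ennreal ((A * m - \<epsilon>) / (F * K)) \<le>
        ennreal (F * K) * lower_density \<alpha>s ns I a"
      by (rule mult_left_mono) simp
    moreover have "ennreal (F * K) * ennreal ((A * m - \<epsilon>) / (F * K)) = ennreal (A * m - \<epsilon>)"
      using FK by (subst ennreal_mult'[symmetric]) auto
    ultimately have "ennreal (A * m - \<epsilon>) + ennreal \<epsilon> \<le> ennreal (F * K) * lower_density \<alpha>s ns I a + ennreal \<epsilon>"
      by (intro add_right_mono) simp
    moreover have "ennreal (A * m) \<le> ennreal (A * m - \<epsilon>) + ennreal \<epsilon>"
    proof (cases "A * m \<ge> \<epsilon>")
      case True
      then show ?thesis using \<epsilon> by (simp flip: ennreal_plus)
    next
      case False
      then show ?thesis by (simp add: add_increasing ennreal_leI)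
    qed
    ultimately show ?thesis by order
  qed
qed

text \<open>
  If almost all \<open>\<parallel>f_i\<parallel>\<^sup>2\<close> are at least \<open>m\<close>, the \<open>f\<close>-sum controls the number of points of \<open>I_N(c)\<close>. For
  finite \<open>I\<close> every \<open>m\<close> is admissible, which makes the density vanish.
\<close>

lemma upper_density_bound:
  assumes m: "m \<ge> 0" "finite {i \<in> I. \<not> m \<le> (norm (f i))\<^sup>2}"
    and K: "K \<ge> 0" "finite {j \<in> G. \<not> (norm (e j))\<^sup>2 \<le> K}"
  shows "ennreal (E * m) * upper_density \<alpha>s ns I a \<le> ennreal (B * K)"
proof (cases "m = 0")
  case False
  then have Em: "E * m > 0" using m bounds_pos by simp
  show ?thesis
  proof (rule ennreal_le_epsilon)
    fix \<epsilon> :: real assume \<epsilon>: "\<epsilon> > 0"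
    define z where "z = E * m * card {i \<in> I. \<not> m \<le> (norm (f i))\<^sup>2} +
      B * F * card {j \<in> G. \<not> (norm (e j))\<^sup>2 \<le> K}"
    have *: "\<epsilon> / 2 > 0" using \<epsilon> by simp
    have "\<forall>\<^sub>F N in sequentially. \<forall>c\<in>G. E * m * (card (ipre N c) / box_card N) \<le> B * K + \<epsilon>"
      using f_sum_le_e_sum[OF *] const_le_box_card[OF *, of z] eventually_ge_at_top[of 2]
    proof eventually_elim
      case (elim N)
      show ?case
      proof
        fix c assume c: "c \<in> G"
        note S = box_finite_card[OF elim(3) c] finite_ipre[OF elim(3) c]
        have "E * (m * card (ipre N c) - m * card {i \<in> I. \<not> m \<le> (norm (f i))\<^sup>2}) \<le> E * f_sum N c"
          using bounds_pos S m ipre_subset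
          by (intro mult_left_mono sum_ge_outside_finite) auto
        also have "\<dots> \<le> B * e_sum N c + \<epsilon> / 2 * card (ibox N c)"
          using elim(1) c by blast
        also have "B * e_sum N c \<le>
            B * (K * card (ibox N c) + F * card {j \<in> G. \<not> (norm (e j))\<^sup>2 \<le> K})"
          using bounds_pos S K box_subset_G e_bounds
          by (intro mult_left_mono sum_le_outside_finite) auto
        finally have "E * m * card (ipre N c) \<le> B * K * box_card N + z + \<epsilon> / 2 * box_card N"
          using S by (simp add: z_def algebra_simps)
        then have "E * m * card (ipre N c) \<le> B * K * box_card N + \<epsilon> * box_card N"
          using elim(2) by linarith
        then show "E * m * (card (ipre N c) / box_card N) \<le> B * K + \<epsilon>"
          using box_card_pos[of N] by (simp add: field_simps)
      qed
    qed
    then have "\<forall>\<^sub>F N in sequentially. (SUP j\<in>G. box_ratio \<alpha>s ns I a N j) \<le> ennreal ((B * K + \<epsilon>) / (E * m))"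
      using eventually_ge_at_top[of 2]
    proof eventually_elim
      case (elim N)
      show ?case
      proof (rule SUP_least)
        fix c assume c: "c \<in> G"
        have "card (ipre N c) / box_card N \<le> (B * K + \<epsilon>) / (E * m)"
          using elim(1) c Em by (simp add: pos_le_divide_eq mult.commute)
        then show "box_ratio \<alpha>s ns I a N c \<le> ennreal ((B * K + \<epsilon>) / (E * m))"
          by (simp add: box_ratio_eq elim(2) c ennreal_leI)
      qed
    qed
    then have "upper_density \<alpha>s ns I a \<le> ennreal ((B * K + \<epsilon>) / (E * m))"
      unfolding upper_density_def by (rule Limsup_bounded)
    then have "ennreal (E * m) * upper_density \<alpha>s ns I a \<le> ennreal (E * m) * ennreal ((B * K + \<epsilon>) / (E * m))"
      by (rule mult_left_mono) simp
    also have "\<dots> = ennreal (B * K + \<epsilon>)"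
      using Em by (subst ennreal_mult'[symmetric]) auto
    also have "\<dots> = ennreal (B * K) + ennreal \<epsilon>"
      using \<epsilon> K bounds_pos by simp
    finally show "ennreal (E * m) * upper_density \<alpha>s ns I a \<le> ennreal (B * K) + ennreal \<epsilon>" .
  qed
qed simp


text \<open>
  Let \<open>m\<close> increase to the lower limit and \<open>K\<close> decrease to the upper limit in \<open>lower_density_bound\<close>. The
  density and the upper limit are finite, so that the product stays meaningful, and a vanishing upper
  limit would make the lower limit vanish as well.
\<close>

lemma lower_density_ge_quotient:
  assumes "\<not> (liminf_on G (\<lambda>j. (norm (e j))\<^sup>2) = 0 \<and> limsup_on I (\<lambda>i. (norm (f i))\<^sup>2) = 0)"
  shows "ennreal (A / F) * (liminf_on G (\<lambda>j. (norm (e j))\<^sup>2) / limsup_on I (\<lambda>i. (norm (f i))\<^sup>2))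
    \<le> lower_density \<alpha>s ns I a"
proof -
  let ?m = "liminf_on G (\<lambda>j. (norm (e j))\<^sup>2)" and ?K = "limsup_on I (\<lambda>i. (norm (f i))\<^sup>2)"
  have "?K \<le> ennreal B" by (rule limsup_on_le) (rule f_bounds)
  then obtain s where s: "?K = ennreal s" "s \<ge> 0" by (cases ?K) (auto simp: top_unique)
  obtain l where l: "lower_density \<alpha>s ns I a = ennreal l" "l \<ge> 0"
    using le_less_trans[OF lower_density_le_upper_density finite_upper_density]
    by (cases "lower_density \<alpha>s ns I a") auto
  have "?m \<le> ennreal (F * s * l / A)"
  proof (rule le_ennrealI_dense)
    fix m :: real assume m: "m \<ge> 0" "ennreal m < ?m"
    have "A * m \<le> K * (F * l)" if "K > s" for K
    proof -
      have "?K < ennreal K" using s that by (simp add: ennreal_less_iff)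
      from lower_density_bound[OF m(1) finite_below_liminf_on[OF m(2)] _ finite_above_limsup_on[OF this]]
      have "ennreal (A * m) \<le> ennreal (F * K) * ennreal l"
        using s that l by simp
      then show ?thesis
        using l s that bounds_pos by (simp add: mult_ac flip: ennreal_mult')
    qed
    then have "A * m \<le> s * (F * l)" by (rule le_mult_approx_above)
    then have "m \<le> F * s * l / A" using bounds_pos by (simp add: field_simps)
    then show "ennreal m \<le> ennreal (F * s * l / A)" by (rule ennreal_leI)
  qed
  then obtain x where x: "?m = ennreal x" "x \<ge> 0" "x \<le> F * s * l / A"
    using s l bounds_pos by (cases ?m) (auto simp: top_unique)
  have "s \<noteq> 0"
    using assms s x by auto
  then show ?thesis
    using s x l bounds_pos by (simp add: divide_ennreal field_simps flip: ennreal_mult')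
qed

text \<open>
  The lower limit is infinite if \<open>I\<close> is finite, so it is bounded by means of real numbers \<open>m\<close> below it;
  if the density is positive, this shows that the lower limit is finite.
\<close>

lemma upper_density_le_quotient:
  assumes "\<not> (limsup_on G (\<lambda>j. (norm (e j))\<^sup>2) = 0 \<and> liminf_on I (\<lambda>i. (norm (f i))\<^sup>2) = 0)"
  shows "upper_density \<alpha>s ns I a
    \<le> ennreal (B / E) * (limsup_on G (\<lambda>j. (norm (e j))\<^sup>2) / liminf_on I (\<lambda>i. (norm (f i))\<^sup>2))"
proof -
  let ?K = "limsup_on G (\<lambda>j. (norm (e j))\<^sup>2)" and ?m = "liminf_on I (\<lambda>i. (norm (f i))\<^sup>2)"
  have "?K \<le> ennreal F" by (rule limsup_on_le) (rule e_bounds)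
  then obtain t where t: "?K = ennreal t" "t \<ge> 0" by (cases ?K) (auto simp: top_unique)
  obtain u where u: "upper_density \<alpha>s ns I a = ennreal u" "u \<ge> 0"
    using finite_upper_density by (cases "upper_density \<alpha>s ns I a") auto
  have bound: "u * (E * m) \<le> t * B" if m: "m \<ge> 0" "ennreal m < ?m" for m
  proof (rule le_mult_approx_above)
    fix K assume "t < K"
    then have "?K < ennreal K" using t by (simp add: ennreal_less_iff)
    from upper_density_bound[OF m(1) finite_below_liminf_on[OF m(2)] _ finite_above_limsup_on[OF this]]
    have "ennreal (E * m) * ennreal u \<le> ennreal (B * K)"
      using t \<open>t < K\<close> u by simp
    then show "u * (E * m) \<le> K * B"
      using u m t \<open>t < K\<close> bounds_pos by (simp add: mult_ac flip: ennreal_mult')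
  qed
  show ?thesis
  proof (cases "u = 0 \<or> ?m = 0")
    case True
    then show ?thesis
      using u t assms bounds_pos by (auto simp: ennreal_divide_zero ennreal_mult_top)
  next
    case False
    then have "u > 0" using u by simp
    have "?m \<le> ennreal (t * B / (u * E))"
    proof (rule le_ennrealI_dense)
      fix m assume "(m::real) \<ge> 0" "ennreal m < ?m"
      from bound[OF this] have "m \<le> t * B / (u * E)"
        using \<open>u > 0\<close> bounds_pos by (simp add: field_simps)
      then show "ennreal m \<le> ennreal (t * B / (u * E))" by (rule ennreal_leI)
    qed
    then obtain x where x: "?m = ennreal x" "x > 0" "x \<le> t * B / (u * E)"
      using False t u bounds_pos by (cases ?m) (auto simp: top_unique less_le)
    then have "u \<le> B / E * (t / x)"
      using \<open>u > 0\<close> bounds_pos by (simp add: field_simps)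
    then show ?thesis
      using u t x bounds_pos by (simp add: divide_ennreal ennreal_leI flip: ennreal_mult')
  qed
qed

lemma vectors_zero_if_frame_zero:
  fixes h :: 'h
  assumes "\<And>i. i \<in> I \<Longrightarrow> f i = 0"
  shows "h = 0"
proof -
  have ip0: "ip h 0 = 0"
    using norm_ip_commute[of h 0] ip_scale_left[of 0 0 h] by simp
  have "ennreal (A * (norm h)\<^sup>2) \<le> (\<Sum>\<^sub>\<infinity>i\<in>I. ennreal ((norm (ip h (f i)))\<^sup>2))"
    using f_frame by (simp add: is_frame_def)
  also have "\<dots> = 0"
    using assms by (intro infsum_0) (simp add: ip0)
  finally show ?thesis
    using bounds_pos by (simp add: mult_le_0_iff)
qed

text \<open>
  Applying the preceding bounds with no exceptional vectors covers finite \<open>I\<close> too, where limits along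
  complements of finite sets carry no information. If \<open>I\<close> is empty, \<open>NF\<close> is an arbitrary real number,
  possibly negative; the absolute value is then an admissible constant.
\<close>

lemma density_bounds_uniform_norms:
  assumes NF: "\<forall>i\<in>I. (norm (f i))\<^sup>2 = NF" and NE: "\<forall>j\<in>G. (norm (e j))\<^sup>2 = NE"
    and nondegenerate: "\<not> (NE = 0 \<and> NF = 0)"
  shows "ennreal (A * NE) / ennreal (F * NF) \<le> lower_density \<alpha>s ns I a" (is ?lower)
    and "upper_density \<alpha>s ns I a \<le> ennreal (B * NE) / ennreal (E * NF)" (is ?upper)
proof -
  have NE0: "NE \<ge> 0" using NE G_nonempty by fastforce
  have abs: "\<forall>i\<in>I. (norm (f i))\<^sup>2 = \<bar>NF\<bar>" using NF by fastforce
  \<comment> \<open>then every \<open>f i\<close> is zero, so the whole space is\<close>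
  have zero: "NE = 0" if "NF \<le> 0"
  proof -
    have "f i = 0" if "i \<in> I" for i
      using NF \<open>NF \<le> 0\<close> that by fastforce
    then have "e j = 0" for j by (rule vectors_zero_if_frame_zero)
    then show ?thesis using NE G_nonempty by auto
  qed
  obtain l where l: "lower_density \<alpha>s ns I a = ennreal l" "l \<ge> 0"
    using le_less_trans[OF lower_density_le_upper_density finite_upper_density]
    by (cases "lower_density \<alpha>s ns I a") auto
  obtain u where u: "upper_density \<alpha>s ns I a = ennreal u" "u \<ge> 0"
    using finite_upper_density by (cases "upper_density \<alpha>s ns I a") auto
  have empty: "{j \<in> G. \<not> NE \<le> (norm (e j))\<^sup>2} = {}" "{i \<in> I. \<not> (norm (f i))\<^sup>2 \<le> \<bar>NF\<bar>} = {}"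
    "{i \<in> I. \<not> \<bar>NF\<bar> \<le> (norm (f i))\<^sup>2} = {}" "{j \<in> G. \<not> (norm (e j))\<^sup>2 \<le> NE} = {}"
    using NE abs by auto
  have "ennreal (A * NE) \<le> ennreal (F * \<bar>NF\<bar>) * ennreal l"
    "ennreal (E * \<bar>NF\<bar>) * ennreal u \<le> ennreal (B * NE)"
    using lower_density_bound[of NE "\<bar>NF\<bar>"] upper_density_bound[of "\<bar>NF\<bar>" NE] NE0 l u unfolding empty
    by simp_all
  then have le: "A * NE \<le> F * \<bar>NF\<bar> * l" "E * \<bar>NF\<bar> * u \<le> B * NE"
    using l u NE0 bounds_pos by (simp_all flip: ennreal_mult')
  have "?lower \<and> ?upper"
  proof (cases "NF > 0")
    case True
    then have "A * NE / (F * NF) \<le> l" "u \<le> B * NE / (E * NF)"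
      using le bounds_pos by (simp_all add: field_simps)
    then show ?thesis
      using True l u NE0 bounds_pos by (simp add: divide_ennreal ennreal_leI)
  next
    case False
    then have "NE = 0" "NF < 0" using zero nondegenerate by auto
    then have "u = 0"
      using le(2) u(2) bounds_pos by (auto simp: zero_le_mult_iff mult_less_0_iff)
    then show ?thesis using \<open>NE = 0\<close> u by simp
  qed
  then show ?lower ?upper by auto
qed

end


section \<open>The density theorem\<close>

theorem theorem3p6:
  fixes scale :: "'k::hilbert_scalar \<Rightarrow> 'h::banach \<Rightarrow> 'h"
    and ip :: "'h \<Rightarrow> 'h \<Rightarrow> 'k"
    and \<alpha>s :: "real list" and ns :: "nat list"
    and I :: "'i set"
    and f :: "'i \<Rightarrow> 'h"
    and e :: "(nat \<Rightarrow> real) \<times> (nat \<Rightarrow> int) \<Rightarrow> 'h"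
    and a :: "'i \<Rightarrow> (nat \<Rightarrow> real) \<times> (nat \<Rightarrow> int)"
    and A B E F :: real
  assumes "separable_hilbert_space scale ip"
    and "length \<alpha>s \<ge> 1" and "\<forall>\<alpha>\<in>set \<alpha>s. \<alpha> > 0" and "\<forall>n\<in>set ns. n > 0"
    and "countable I"
    and "is_frame ip f I A B"
    and "is_frame ip e (carrier (index_group \<alpha>s ns)) E F"
    and "a \<in> I \<rightarrow> carrier (index_group \<alpha>s ns)"
    and "upper_density \<alpha>s ns I a < \<infinity>"
    and "l2_column_decay \<alpha>s ns ip f I a e"
    and "l2_row_decay \<alpha>s ns ip f I a e"
  shows
    "(\<forall>p c. free_ultrafilter p \<longrightarrow> (\<forall>N. c N \<in> carrier (index_group \<alpha>s ns)) \<longrightarrow>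
        ennreal (1 / F) * Lim p (\<lambda>N. average_on (box_at \<alpha>s ns N (c N)) (\<lambda>j. (norm (e j))\<^sup>2))
          \<le> density_along \<alpha>s ns I a p c / ennreal A *
             Lim p (\<lambda>N. average_on (pre_box \<alpha>s ns I a N (c N)) (\<lambda>i. (norm (f i))\<^sup>2)) \<and>
        ennreal (1 / E) * Lim p (\<lambda>N. average_on (box_at \<alpha>s ns N (c N)) (\<lambda>j. (norm (e j))\<^sup>2))
          \<ge> density_along \<alpha>s ns I a p c / ennreal B *
             Lim p (\<lambda>N. average_on (pre_box \<alpha>s ns I a N (c N)) (\<lambda>i. (norm (f i))\<^sup>2))) \<and>
     (let G = carrier (index_group \<alpha>s ns);
              e_inf = liminf_on G (\<lambda>j. (norm (e j))\<^sup>2); e_sup = limsup_on G (\<lambda>j. (norm (e j))\<^sup>2);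
              f_inf = liminf_on I (\<lambda>i. (norm (f i))\<^sup>2); f_sup = limsup_on I (\<lambda>i. (norm (f i))\<^sup>2)
          in (\<not> (e_inf = 0 \<and> f_sup = 0) \<longrightarrow>
                ennreal (A / F) * (e_inf / f_sup) \<le> lower_density \<alpha>s ns I a) \<and>
             lower_density \<alpha>s ns I a \<le> upper_density \<alpha>s ns I a \<and>
             (\<not> (e_sup = 0 \<and> f_inf = 0) \<longrightarrow>
                upper_density \<alpha>s ns I a \<le> ennreal (B / E) * (e_sup / f_inf))) \<and>
     (\<forall>NF NE. (\<forall>i\<in>I. (norm (f i))\<^sup>2 = NF) \<longrightarrow>
           (\<forall>j\<in>carrier (index_group \<alpha>s ns). (norm (e j))\<^sup>2 = NE) \<longrightarrow>
           \<not> (NE = 0 \<and> NF = 0) \<longrightarrow>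
             ennreal (A * NE) / ennreal (F * NF) \<le> lower_density \<alpha>s ns I a \<and>
             lower_density \<alpha>s ns I a \<le> upper_density \<alpha>s ns I a \<and>
             upper_density \<alpha>s ns I a \<le> ennreal (B * NE) / ennreal (E * NF) \<and>
             (A = B \<and> E = F \<longrightarrow>
                uniform_density \<alpha>s ns I a \<and>
                lower_density \<alpha>s ns I a = ennreal (A * NE) / ennreal (E * NF) \<and>
                upper_density \<alpha>s ns I a = ennreal (A * NE) / ennreal (E * NF)))"
proof -
  interpret separable_hilbert_space scale ip by fact
  interpret decaying_frame_pair scale ip \<alpha>s ns I a f e A B E F
    by unfold_locales fact+
  have a1: "ennreal (1 / F) * Lim p (\<lambda>N. average_on (box_at \<alpha>s ns N (c N)) (\<lambda>j. (norm (e j))\<^sup>2))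
          \<le> density_along \<alpha>s ns I a p c / ennreal A *
             Lim p (\<lambda>N. average_on (pre_box \<alpha>s ns I a N (c N)) (\<lambda>i. (norm (f i))\<^sup>2))"
    and a2: "density_along \<alpha>s ns I a p c / ennreal B *
             Lim p (\<lambda>N. average_on (pre_box \<alpha>s ns I a N (c N)) (\<lambda>i. (norm (f i))\<^sup>2))
         \<le> ennreal (1 / E) * Lim p (\<lambda>N. average_on (box_at \<alpha>s ns N (c N)) (\<lambda>j. (norm (e j))\<^sup>2))"
    if "free_ultrafilter p" "\<forall>N. c N \<in> G" for p c
  proof -
    have quotient: "D / ennreal r * y = ennreal (1 / r) * (D * y)" if "r > 0" for D y r
      using that by (simp add: divide_ennreal_def inverse_ennreal inverse_eq_divide mult_ac)
    show "ennreal (1 / F) * Lim p (\<lambda>N. average_on (box_at \<alpha>s ns N (c N)) (\<lambda>j. (norm (e j))\<^sup>2))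
          \<le> density_along \<alpha>s ns I a p c / ennreal A *
             Lim p (\<lambda>N. average_on (pre_box \<alpha>s ns I a N (c N)) (\<lambda>i. (norm (f i))\<^sup>2))"
      unfolding quotient[OF bounds_pos(1)]
      using that bounds_pos by (intro ennreal_cross_divide averages_along_ultrafilter(1)) auto
    show "density_along \<alpha>s ns I a p c / ennreal B *
             Lim p (\<lambda>N. average_on (pre_box \<alpha>s ns I a N (c N)) (\<lambda>i. (norm (f i))\<^sup>2))
         \<le> ennreal (1 / E) * Lim p (\<lambda>N. average_on (box_at \<alpha>s ns N (c N)) (\<lambda>j. (norm (e j))\<^sup>2))"
      unfolding quotient[OF bounds_pos(2)]
      using that bounds_pos by (intro ennreal_cross_divide averages_along_ultrafilter(2)) auto
  qed
  have tight: "lower_density \<alpha>s ns I a = upper_density \<alpha>s ns I a"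
      "lower_density \<alpha>s ns I a = ennreal (A * NE) / ennreal (E * NF)"
      "upper_density \<alpha>s ns I a = ennreal (A * NE) / ennreal (E * NF)"
    if "\<forall>i\<in>I. (norm (f i))\<^sup>2 = NF" "\<forall>j\<in>G. (norm (e j))\<^sup>2 = NE" "\<not> (NE = 0 \<and> NF = 0)"
      "A = B" "E = F" for NF NE
    using density_bounds_uniform_norms[OF that(1-3)] lower_density_le_upper_density that(4,5)
    by (auto intro: order_antisym order_trans)
  show ?thesis
    unfolding Let_def uniform_density_def
    by (intro conjI allI impI; (elim conjE)?;
        (rule a1 a2 lower_density_ge_quotient upper_density_le_quotient lower_density_le_upper_density
          density_bounds_uniform_norms tight; assumption))
qed

end
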